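(* Over $\mathsf{RCA}_0^*$, the following are equivalent. (1) $\mathsf{I}\Sigma^0_1$, the induction scheme for $\Sigma^0_1$ formulas. (2) $\mathsf{ERT}$: for every $k\in\mathbb N$ and every $f:\mathbb N\to k$ there is a $b\in\mathbb N$ such that for all $x\ge b$ there is a $y\ge b$ such that $x\neq y$ and $f(x)=f(y)$. (3) $\forall j\,\mathsf{ERT}(j)$: for every $j\in\mathbb N$, every $k\in\mathbb N$ and every $f:\mathbb N\to k$ there is a $b\in\mathbb N$ such that every value that $f$ takes at some argument $x\ge b$ is taken by $f$ at at least $j$ distinct arguments $y\ge b$.
   Context: $\mathsf{RCA}_0$ is the subsystem of second order arithmetic with basic arithmetic axioms, $\Sigma^0_1$ induction, and recursive ($\Delta^0_1$) comprehension. $\mathsf{RCA}_0^*$ has the axioms of $\mathsf{RCA}_0$ less the $\Sigma^0_1$ induction scheme, with the addition of a $\Sigma^0_0$ induction scheme and function symbols and axioms for integer exponentiation. The number $k$ is identified with $\{0,\dots,k-1\}$; functions are coded by sets; number quantifiers range over all numbers of the model. *)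

theory Defs
  imports Main
begin

text \<open>
  A structure for the language of second order arithmetic with exponentiation. The numbers of the
  model are all elements of the type \<open>'a\<close>; set variables range over the family \<open>SetPart\<close>, as in
  Henkin semantics. A statement holds over a theory if it holds in all models of that theory.
\<close>

record 'a l2_structure =
  NZero :: 'a
  NOne :: 'a
  NAdd :: "'a \<Rightarrow> 'a \<Rightarrow> 'a"
  NMul :: "'a \<Rightarrow> 'a \<Rightarrow> 'a"
  NExp :: "'a \<Rightarrow> 'a \<Rightarrow> 'a"
  NLess :: "'a \<Rightarrow> 'a \<Rightarrow> bool"
  SetPart :: "'a set set"

definition NLeq :: "'a l2_structure \<Rightarrow> 'a \<Rightarrow> 'a \<Rightarrow> bool" where
  "NLeq M m n \<longleftrightarrow> NLess M m n \<or> m = n"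

definition NSuc :: "'a l2_structure \<Rightarrow> 'a \<Rightarrow> 'a" where
  "NSuc M n = NAdd M n (NOne M)"


text \<open>
  Formulas without set quantifiers, which suffice for the schemes below. Number variables and set
  variables are two separate sorts, both named by natural numbers; set variables serve as set
  parameters.
\<close>

datatype l2_term =
    TVar nat
  | TZero
  | TOne
  | TAdd l2_term l2_term
  | TMul l2_term l2_term
  | TExp l2_term l2_term

datatype l2_formula =
    FEq l2_term l2_term
  | FLess l2_term l2_term
  | FMem l2_term nat
  | FNeg l2_formula
  | FAnd l2_formula l2_formula
  | FOr l2_formula l2_formula
  | FImp l2_formula l2_formula
  | FAll nat l2_formula
  | FEx nat l2_formula

primrec term_vars :: "l2_term \<Rightarrow> nat set" where
  "term_vars (TVar x) = {x}"
| "term_vars TZero = {}"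
| "term_vars TOne = {}"
| "term_vars (TAdd s t) = term_vars s \<union> term_vars t"
| "term_vars (TMul s t) = term_vars s \<union> term_vars t"
| "term_vars (TExp s t) = term_vars s \<union> term_vars t"

primrec term_val :: "'a l2_structure \<Rightarrow> (nat \<Rightarrow> 'a) \<Rightarrow> l2_term \<Rightarrow> 'a" where
  "term_val M e (TVar x) = e x"
| "term_val M e TZero = NZero M"
| "term_val M e TOne = NOne M"
| "term_val M e (TAdd s t) = NAdd M (term_val M e s) (term_val M e t)"
| "term_val M e (TMul s t) = NMul M (term_val M e s) (term_val M e t)"
| "term_val M e (TExp s t) = NExp M (term_val M e s) (term_val M e t)"

primrec l2_sat :: "'a l2_structure \<Rightarrow> (nat \<Rightarrow> 'a) \<Rightarrow> (nat \<Rightarrow> 'a set) \<Rightarrow> l2_formula \<Rightarrow> bool" where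
  "l2_sat M e E (FEq s t) \<longleftrightarrow> term_val M e s = term_val M e t"
| "l2_sat M e E (FLess s t) \<longleftrightarrow> NLess M (term_val M e s) (term_val M e t)"
| "l2_sat M e E (FMem t X) \<longleftrightarrow> term_val M e t \<in> E X"
| "l2_sat M e E (FNeg p) \<longleftrightarrow> \<not> l2_sat M e E p"
| "l2_sat M e E (FAnd p q) \<longleftrightarrow> l2_sat M e E p \<and> l2_sat M e E q"
| "l2_sat M e E (FOr p q) \<longleftrightarrow> l2_sat M e E p \<or> l2_sat M e E q"
| "l2_sat M e E (FImp p q) \<longleftrightarrow> (l2_sat M e E p \<longrightarrow> l2_sat M e E q)"
| "l2_sat M e E (FAll x p) \<longleftrightarrow> (\<forall>a. l2_sat M (e(x := a)) E p)"
| "l2_sat M e E (FEx x p) \<longleftrightarrow> (\<exists>a. l2_sat M (e(x := a)) E p)"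

text \<open>The bounding term of a bounded quantifier must not contain the quantified variable.\<close>

inductive Sigma00 :: "l2_formula \<Rightarrow> bool" where
  "Sigma00 (FEq s t)"
| "Sigma00 (FLess s t)"
| "Sigma00 (FMem t X)"
| "Sigma00 p \<Longrightarrow> Sigma00 (FNeg p)"
| "Sigma00 p \<Longrightarrow> Sigma00 q \<Longrightarrow> Sigma00 (FAnd p q)"
| "Sigma00 p \<Longrightarrow> Sigma00 q \<Longrightarrow> Sigma00 (FOr p q)"
| "Sigma00 p \<Longrightarrow> Sigma00 q \<Longrightarrow> Sigma00 (FImp p q)"
| "Sigma00 p \<Longrightarrow> x \<notin> term_vars t \<Longrightarrow> Sigma00 (FAll x (FImp (FLess (TVar x) t) p))"
| "Sigma00 p \<Longrightarrow> x \<notin> term_vars t \<Longrightarrow> Sigma00 (FEx x (FAnd (FLess (TVar x) t) p))"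

definition Sigma01 :: "l2_formula \<Rightarrow> bool" where
  "Sigma01 p \<longleftrightarrow> (\<exists>x q. Sigma00 q \<and> p = FEx x q)"

definition Pi01 :: "l2_formula \<Rightarrow> bool" where
  "Pi01 p \<longleftrightarrow> (\<exists>x q. Sigma00 q \<and> p = FAll x q)"


definition set_env :: "'a l2_structure \<Rightarrow> (nat \<Rightarrow> 'a set) \<Rightarrow> bool" where
  "set_env M E \<longleftrightarrow> (\<forall>X. E X \<in> SetPart M)"

definition induction_scheme :: "'a l2_structure \<Rightarrow> (l2_formula \<Rightarrow> bool) \<Rightarrow> bool" where
  "induction_scheme M \<Phi> \<longleftrightarrow>
    (\<forall>p x e E. \<Phi> p \<longrightarrow> set_env M E \<longrightarrow>
      l2_sat M (e(x := NZero M)) E p \<longrightarrow>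
      (\<forall>n. l2_sat M (e(x := n)) E p \<longrightarrow> l2_sat M (e(x := NSuc M n)) E p) \<longrightarrow>
      (\<forall>n. l2_sat M (e(x := n)) E p))"

definition Delta01_comprehension :: "'a l2_structure \<Rightarrow> bool" where
  "Delta01_comprehension M \<longleftrightarrow>
    (\<forall>p q x e E. Sigma01 p \<longrightarrow> Pi01 q \<longrightarrow> set_env M E \<longrightarrow>
      (\<forall>n. l2_sat M (e(x := n)) E p \<longleftrightarrow> l2_sat M (e(x := n)) E q) \<longrightarrow>
      {n. l2_sat M (e(x := n)) E p} \<in> SetPart M)"

definition basic_axioms :: "'a l2_structure \<Rightarrow> bool" where
  "basic_axioms M \<longleftrightarrow>
    (\<forall>n. NSuc M n \<noteq> NZero M) \<and>
    (\<forall>m n. NSuc M m = NSuc M n \<longrightarrow> m = n) \<and>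
    (\<forall>m. NAdd M m (NZero M) = m) \<and>
    (\<forall>m n. NAdd M m (NSuc M n) = NSuc M (NAdd M m n)) \<and>
    (\<forall>m. NMul M m (NZero M) = NZero M) \<and>
    (\<forall>m n. NMul M m (NSuc M n) = NAdd M (NMul M m n) m) \<and>
    (\<forall>m. \<not> NLess M m (NZero M)) \<and>
    (\<forall>m n. NLess M m (NSuc M n) \<longleftrightarrow> NLess M m n \<or> m = n)"

definition exp_axioms :: "'a l2_structure \<Rightarrow> bool" where
  "exp_axioms M \<longleftrightarrow>
    (\<forall>m. NExp M m (NZero M) = NOne M) \<and>
    (\<forall>m n. NExp M m (NSuc M n) = NMul M (NExp M m n) m)"

text \<open>
  The set sort, like every sort, is nonempty. This has to be required explicitly: without any
  assignment of the set variables, comprehension would hold vacuously.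
\<close>

definition models_RCA0_star :: "'a l2_structure \<Rightarrow> bool" where
  "models_RCA0_star M \<longleftrightarrow>
    SetPart M \<noteq> {} \<and>
    basic_axioms M \<and>
    exp_axioms M \<and>
    induction_scheme M Sigma00 \<and>
    Delta01_comprehension M"

definition ISigma01 :: "'a l2_structure \<Rightarrow> bool" where
  "ISigma01 M \<longleftrightarrow> induction_scheme M Sigma01"


text \<open>The usual pairing map of second order arithmetic, \<open>(m, n) \<mapsto> (m + n)\<^sup>2 + m\<close>.\<close>

definition NPair :: "'a l2_structure \<Rightarrow> 'a \<Rightarrow> 'a \<Rightarrow> 'a" where
  "NPair M m n = NAdd M (NMul M (NAdd M m n) (NAdd M m n)) m"

definition NBelow :: "'a l2_structure \<Rightarrow> 'a \<Rightarrow> 'a set" where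
  "NBelow M k = {n. NLess M n k}"

text \<open>The codes in the model of functions from \<open>A\<close> to \<open>B\<close>: sets of pairs.\<close>

definition fun_codes :: "'a l2_structure \<Rightarrow> 'a set \<Rightarrow> 'a set \<Rightarrow> 'a set set" where
  "fun_codes M A B =
    {F \<in> SetPart M. F \<subseteq> {NPair M x y | x y. x \<in> A \<and> y \<in> B} \<and>
                    (\<forall>x\<in>A. \<exists>!y. y \<in> B \<and> NPair M x y \<in> F)}"

definition fun_app :: "'a l2_structure \<Rightarrow> 'a set \<Rightarrow> 'a \<Rightarrow> 'a" where
  "fun_app M F x = (THE y. NPair M x y \<in> F)"

definition ERT :: "'a l2_structure \<Rightarrow> bool" where
  "ERT M \<longleftrightarrow>
    (\<forall>k. \<forall>F \<in> fun_codes M UNIV (NBelow M k).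
      \<exists>b. \<forall>x. NLeq M b x \<longrightarrow>
        (\<exists>y. NLeq M b y \<and> x \<noteq> y \<and> fun_app M F x = fun_app M F y))"

text \<open>
  Here \<open>j\<close> may be a nonstandard number of the model, so that ``at least \<open>j\<close> distinct arguments''
  has to be read inside the model: there is a one-to-one function \<open>G\<close> of the model, defined on
  \<open>j = {0, \<dots>, j - 1}\<close>, that lists such arguments.
\<close>

definition ERT_mult :: "'a l2_structure \<Rightarrow> 'a \<Rightarrow> bool" where
  "ERT_mult M j \<longleftrightarrow>
    (\<forall>k. \<forall>F \<in> fun_codes M UNIV (NBelow M k).
      \<exists>b. \<forall>x. NLeq M b x \<longrightarrow>
        (\<exists>G \<in> fun_codes M (NBelow M j) UNIV.
          inj_on (fun_app M G) (NBelow M j) \<and>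
          (\<forall>i \<in> NBelow M j. NLeq M b (fun_app M G i) \<and>
                            fun_app M F (fun_app M G i) = fun_app M F x)))"

end

theory Submission
  imports Defs
begin

text \<open>
  Everything takes place inside one model \<open>M\<close>; the equivalences follow from four implications.

  From repetition to induction. If induction fails at \<open>a\<close> for \<open>\<exists>y. \<phi> n y\<close>, let \<open>w\<^sub>n\<close> be the least
  bound below which every \<open>m < n\<close> has a witness. It exists exactly for the \<open>n\<close> in a proper cut of the
  model. Colour \<open>x\<close> by the largest \<open>n\<close> with \<open>w\<^sub>n = x\<close>, and by \<open>a + 1\<close> if there is none. Each
  colour below \<open>a + 1\<close> is used at most once, but such colours occur arbitrarily late, because the cut
  has no last element; so the colouring contradicts repetition (\<open>ERT_imp_induct\<close>).

  From induction to repetition. Assume that for every \<open>b\<close> some colour occurs exactly once from \<open>b\<close>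
  on. Collect such places into finite sets: a chain is a finite set \<open>X\<close> of places with
  distinct colours such that no place before \<open>x \<in> X\<close>, but after the preceding element of \<open>X\<close> if there
  is one, has the colour of \<open>x\<close>. A chain whose colours never occur after their
  place in it can always be extended. Finding chains of maximal length directly would take induction
  for more complex formulas. Instead, a chain is described by its pattern, the set of all pairs
  \<open>(f(x), f(y))\<close> with \<open>x \<le> y\<close> in \<open>X\<close>. There are boundedly many patterns, and a pattern determines the
  chain. For a pattern, being realised by a chain and being refuted by a later repetition are both
  \<open>\<Sigma>\<^sup>0\<^sub>1\<close>, so strong bounding decides both for all patterns at once, below a common bound. Hence some
  realised and unrefuted pattern is maximal for inclusion. Extending its chain gives a larger one, a
  contradiction (\<open>strong_bounding\<close>, \<open>pattern_determines_chain\<close>, \<open>eventually_repeats\<close>).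

  From repetition to multiple repetition. Let \<open>p(x)\<close> be the number, modulo \<open>j\<close>, of earlier places of
  the same colour as \<open>x\<close>, and apply repetition to \<open>x \<mapsto> (f(x), p(x))\<close>. From one
  place to a later one that agrees with it in colour and in \<open>p\<close>, the places of that colour run through
  all values of \<open>p\<close>. So \<open>i < j\<close> can
  be sent to the least place of the colour from \<open>b\<close> on with \<open>p\<close>-value \<open>i\<close>, which is one-to-one
  (\<open>bounded_recursion\<close>, \<open>cyclic_orbit_all\<close>, \<open>ERT_mult_of_ERT\<close>). The converse is the case \<open>j = 2\<close>.

  Induction and comprehension speak of formulas. To apply them to relations of the logic, the
  relations definable by bounded formulas with parameters are shown to be closed under the usual
  operations. From induction on them come an ordered semiring and the coding of finite sets by the
  binary expansions of numbers.
\<close>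

section \<open>Bounded definability in a structure\<close>

primrec ren_term :: "(nat \<Rightarrow> nat) \<Rightarrow> l2_term \<Rightarrow> l2_term" where
  "ren_term h (TVar x) = TVar (h x)"
| "ren_term h TZero = TZero"
| "ren_term h TOne = TOne"
| "ren_term h (TAdd s t) = TAdd (ren_term h s) (ren_term h t)"
| "ren_term h (TMul s t) = TMul (ren_term h s) (ren_term h t)"
| "ren_term h (TExp s t) = TExp (ren_term h s) (ren_term h t)"

primrec ren_formula :: "(nat \<Rightarrow> nat) \<Rightarrow> (nat \<Rightarrow> nat) \<Rightarrow> l2_formula \<Rightarrow> l2_formula" where
  "ren_formula h g (FEq s t) = FEq (ren_term h s) (ren_term h t)"
| "ren_formula h g (FLess s t) = FLess (ren_term h s) (ren_term h t)"
| "ren_formula h g (FMem t X) = FMem (ren_term h t) (g X)"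
| "ren_formula h g (FNeg p) = FNeg (ren_formula h g p)"
| "ren_formula h g (FAnd p q) = FAnd (ren_formula h g p) (ren_formula h g q)"
| "ren_formula h g (FOr p q) = FOr (ren_formula h g p) (ren_formula h g q)"
| "ren_formula h g (FImp p q) = FImp (ren_formula h g p) (ren_formula h g q)"
| "ren_formula h g (FAll x p) = FAll (h x) (ren_formula h g p)"
| "ren_formula h g (FEx x p) = FEx (h x) (ren_formula h g p)"

lemma term_val_ren [simp]: "term_val M e (ren_term h t) = term_val M (e \<circ> h) t"
  by (induction t) auto

lemma term_vars_ren [simp]: "term_vars (ren_term h t) = h ` term_vars t"
  by (induction t) auto

lemma fun_upd_comp_inj: "inj h \<Longrightarrow> e(h x := a) \<circ> h = (e \<circ> h)(x := a)"
  by (auto simp: fun_eq_iff inj_def)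

lemma l2_sat_ren:
  "inj h \<Longrightarrow> l2_sat M e E (ren_formula h g p) \<longleftrightarrow> l2_sat M (e \<circ> h) (E \<circ> g) p"
  by (induction p arbitrary: e) (simp_all add: fun_upd_comp_inj)

lemma Sigma00_ren: "Sigma00 p \<Longrightarrow> inj h \<Longrightarrow> Sigma00 (ren_formula h g p)"
  by (induction rule: Sigma00.induct) (simp_all add: Sigma00.intros inj_image_mem_iff)

text \<open>
  Even variables hold the arguments of a defined relation and odd variables its parameters. A set
  of variables split like this always has room: the parameters of two formulas can be moved to
  disjoint odd positions without touching the arguments.
\<close>

definition merge :: "(nat \<Rightarrow> 'b) \<Rightarrow> (nat \<Rightarrow> 'b) \<Rightarrow> nat \<Rightarrow> 'b" where
  "merge e d n = (if even n then e (n div 2) else d (n div 2))"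

text \<open>
  The arguments of a relation form a sequence, so that \<open>e 0\<close>, \<open>e 1\<close>, \<open>\<dots>\<close> play the role of de Bruijn
  indices. Number and set parameters of the model are hidden in the definition, and elements of the
  model may therefore occur freely in definable relations.
\<close>

definition delta0 :: "'a l2_structure \<Rightarrow> ((nat \<Rightarrow> 'a) \<Rightarrow> bool) \<Rightarrow> bool" where
  "delta0 M R \<longleftrightarrow>
    (\<exists>p d E. Sigma00 p \<and> set_env M E \<and> (\<forall>e. R e \<longleftrightarrow> l2_sat M (merge e d) E p))"

definition delta0_term :: "'a l2_structure \<Rightarrow> ((nat \<Rightarrow> 'a) \<Rightarrow> 'a) \<Rightarrow> bool" where
  "delta0_term M f \<longleftrightarrow> (\<exists>t d. \<forall>e. f e = term_val M (merge e d) t)"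

text \<open>Parameters \<open>d\<close> and \<open>d'\<close> of two formulas are interleaved into \<open>merge d d'\<close>.\<close>

definition left_var :: "nat \<Rightarrow> nat" where
  "left_var n = (if even n then n else 2 * n - 1)"

definition right_var :: "nat \<Rightarrow> nat" where
  "right_var n = (if even n then n else 2 * n + 1)"

lemma inj_left_var: "inj left_var"
proof (rule injI)
  fix m n assume "left_var m = left_var n"
  then show "m = n"
    by (cases "even m"; cases "even n") (auto simp: left_var_def elim!: evenE oddE, presburger+)
qed

lemma inj_right_var: "inj right_var"
proof (rule injI)
  fix m n assume "right_var m = right_var n"
  then show "m = n"
    by (cases "even m"; cases "even n") (auto simp: right_var_def elim!: evenE oddE, presburger+)
qed

lemma merge_left_var: "merge e (merge d d') \<circ> left_var = merge e d"
proof
  fix n show "(merge e (merge d d') \<circ> left_var) n = merge e d n"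
  proof (cases "even n")
    case False
    then obtain b where "n = 2 * b + 1" by (rule oddE)
    then have "left_var n = 2 * (2 * b) + 1" "n = 2 * b + 1" by (simp_all add: left_var_def)
    then show ?thesis by (simp add: merge_def)
  qed (simp add: merge_def left_var_def)
qed

lemma merge_right_var: "merge e (merge d d') \<circ> right_var = merge e d'"
proof
  fix n show "(merge e (merge d d') \<circ> right_var) n = merge e d' n"
  proof (cases "even n")
    case False
    then obtain b where "n = 2 * b + 1" by (rule oddE)
    then have "right_var n = 2 * (2 * b + 1) + 1" "n = 2 * b + 1" by (simp_all add: right_var_def)
    then show ?thesis by (simp add: merge_def)
  qed (simp add: merge_def right_var_def)
qed

lemma merge_sets: "merge E E' \<circ> (\<lambda>X. 2 * X) = E" "merge E E' \<circ> (\<lambda>X. 2 * X + 1) = E'"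
  by (auto simp: merge_def fun_eq_iff)

lemma set_env_merge: "set_env M E \<Longrightarrow> set_env M E' \<Longrightarrow> set_env M (merge E E')"
  by (auto simp: set_env_def merge_def)

lemma delta0_obtain2:
  assumes "delta0 M R" "delta0 M R'"
  obtains p p' d E where "Sigma00 p" "Sigma00 p'" "set_env M E"
    "\<And>e. R e \<longleftrightarrow> l2_sat M (merge e d) E p" "\<And>e. R' e \<longleftrightarrow> l2_sat M (merge e d) E p'"
proof -
  obtain p d E where 1: "Sigma00 p" "set_env M E" "\<And>e. R e \<longleftrightarrow> l2_sat M (merge e d) E p"
    using assms(1) by (auto simp: delta0_def)
  obtain p' d' E' where 2: "Sigma00 p'" "set_env M E'" "\<And>e. R' e \<longleftrightarrow> l2_sat M (merge e d') E' p'"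
    using assms(2) by (auto simp: delta0_def)
  show ?thesis
  proof (rule that)
    show "Sigma00 (ren_formula left_var (\<lambda>X. 2 * X) p)" "Sigma00 (ren_formula right_var (\<lambda>X. 2 * X + 1) p')"
      using 1 2 by (auto intro: Sigma00_ren inj_left_var inj_right_var)
    show "set_env M (merge E E')" using 1 2 by (intro set_env_merge)
    show "R e = l2_sat M (merge e (merge d d')) (merge E E') (ren_formula left_var (\<lambda>X. 2 * X) p)" for e
      by (simp only: l2_sat_ren[OF inj_left_var] merge_left_var merge_sets 1)
    show "R' e = l2_sat M (merge e (merge d d')) (merge E E') (ren_formula right_var (\<lambda>X. 2 * X + 1) p')" for e
      by (simp only: l2_sat_ren[OF inj_right_var] merge_right_var merge_sets 2)
  qed
qed

lemma delta0_term_obtain2: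
  assumes "delta0_term M f" "delta0_term M g"
  obtains s t d where
    "\<And>e. f e = term_val M (merge e d) s" "\<And>e. g e = term_val M (merge e d) t"
proof -
  obtain s d where 1: "\<And>e. f e = term_val M (merge e d) s"
    using assms(1) by (auto simp: delta0_term_def)
  obtain t d' where 2: "\<And>e. g e = term_val M (merge e d') t"
    using assms(2) by (auto simp: delta0_term_def)
  show ?thesis
    by (rule that[of "merge d d'" "ren_term left_var s" "ren_term right_var t"])
      (simp_all only: term_val_ren merge_left_var merge_right_var 1 2)
qed

lemma delta0_obtain_term:
  assumes "delta0 M R" "delta0_term M f"
  obtains p t d E where "Sigma00 p" "set_env M E"
    "\<And>e. R e \<longleftrightarrow> l2_sat M (merge e d) E p" "\<And>e. f e = term_val M (merge e d) t"
proof -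
  obtain p d E where 1: "Sigma00 p" "set_env M E" "\<And>e. R e \<longleftrightarrow> l2_sat M (merge e d) E p"
    using assms(1) by (auto simp: delta0_def)
  obtain t d' where 2: "\<And>e. f e = term_val M (merge e d') t"
    using assms(2) by (auto simp: delta0_term_def)
  show ?thesis
  proof (rule that)
    show "Sigma00 (ren_formula left_var id p)"
      using 1 by (auto intro: Sigma00_ren inj_left_var)
    show "set_env M E" by fact
    show "R e = l2_sat M (merge e (merge d d')) E (ren_formula left_var id p)" for e
      by (simp only: l2_sat_ren[OF inj_left_var] merge_left_var comp_id 1)
    show "f e = term_val M (merge e (merge d d')) (ren_term right_var t)" for e
      by (simp only: term_val_ren merge_right_var 2)
  qed
qed

lemma delta0_term_var: "delta0_term M (\<lambda>e. e n)"
  unfolding delta0_term_def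
  by (rule exI[of _ "TVar (2 * n)"]) (simp add: merge_def)

lemma delta0_term_const: "delta0_term M (\<lambda>e. c)"
  unfolding delta0_term_def
  by (rule exI[of _ "TVar 1"], rule exI[of _ "\<lambda>_. c"]) (simp add: merge_def)

lemma delta0_term_add:
  assumes "delta0_term M f" "delta0_term M g"
  shows "delta0_term M (\<lambda>e. NAdd M (f e) (g e))"
proof (rule delta0_term_obtain2[OF assms])
  fix s t d
  assume *: "\<And>e. f e = term_val M (merge e d) s" "\<And>e. g e = term_val M (merge e d) t"
  show ?thesis unfolding delta0_term_def *
    by (rule exI[of _ "TAdd s t"], rule exI[of _ d]) simp
qed

lemma delta0_term_mul:
  assumes "delta0_term M f" "delta0_term M g"
  shows "delta0_term M (\<lambda>e. NMul M (f e) (g e))"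
proof (rule delta0_term_obtain2[OF assms])
  fix s t d
  assume *: "\<And>e. f e = term_val M (merge e d) s" "\<And>e. g e = term_val M (merge e d) t"
  show ?thesis unfolding delta0_term_def *
    by (rule exI[of _ "TMul s t"], rule exI[of _ d]) simp
qed

lemma delta0_term_exp:
  assumes "delta0_term M f" "delta0_term M g"
  shows "delta0_term M (\<lambda>e. NExp M (f e) (g e))"
proof (rule delta0_term_obtain2[OF assms])
  fix s t d
  assume *: "\<And>e. f e = term_val M (merge e d) s" "\<And>e. g e = term_val M (merge e d) t"
  show ?thesis unfolding delta0_term_def *
    by (rule exI[of _ "TExp s t"], rule exI[of _ d]) simp
qed

lemma delta0_term_pair:
  assumes "delta0_term M f" "delta0_term M g"
  shows "delta0_term M (\<lambda>e. NPair M (f e) (g e))"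
  unfolding NPair_def by (intro delta0_term_add delta0_term_mul assms)

lemma merge_rename_live: "merge e d \<circ> (\<lambda>n. if even n then 2 * h (n div 2) else n) = merge (\<lambda>n. e (h n)) d"
  by (auto simp: merge_def fun_eq_iff)

lemma delta0_term_rename:
  assumes "delta0_term M f"
  shows "delta0_term M (\<lambda>e. f (\<lambda>n. e (h n)))"
proof -
  obtain t d where 1: "\<And>e. f e = term_val M (merge e d) t"
    using assms by (auto simp: delta0_term_def)
  show ?thesis unfolding delta0_term_def
    by (rule exI[of _ "ren_term (\<lambda>n. if even n then 2 * h (n div 2) else n) t"], rule exI[of _ d])
      (simp only: term_val_ren merge_rename_live 1 simp_thms)
qed

lemma delta0_rename:
  assumes "delta0 M R" and h: "inj h"
  shows "delta0 M (\<lambda>e. R (\<lambda>n. e (h n)))"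
proof -
  let ?h = "\<lambda>n. if even n then 2 * h (n div 2) else n"
  have inj: "inj ?h"
  proof (rule injI)
    fix m n assume "?h m = ?h n"
    then have "even m = even n" "even m \<Longrightarrow> m div 2 = n div 2" "odd m \<Longrightarrow> m = n"
      by (auto simp: inj_eq[OF h] split: if_splits)
    then show "m = n" by (metis even_two_times_div_two)
  qed
  obtain p d E where 1: "Sigma00 p" "set_env M E" "\<And>e. R e \<longleftrightarrow> l2_sat M (merge e d) E p"
    using assms(1) by (auto simp: delta0_def)
  show ?thesis unfolding delta0_def
  proof (intro exI conjI allI)
    show "Sigma00 (ren_formula ?h id p)" using 1 inj by (intro Sigma00_ren)
    show "set_env M E" by fact
    show "R (\<lambda>n. e (h n)) = l2_sat M (merge e d) E (ren_formula ?h id p)" for e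
      by (simp only: l2_sat_ren[OF inj] merge_rename_live comp_id 1)
  qed
qed

lemma delta0I:
  "Sigma00 p \<Longrightarrow> set_env M E \<Longrightarrow> (\<And>e. R e \<longleftrightarrow> l2_sat M (merge e d) E p) \<Longrightarrow> delta0 M R"
  unfolding delta0_def by blast

lemma delta0_not:
  assumes "delta0 M R"
  shows "delta0 M (\<lambda>e. \<not> R e)"
proof -
  obtain p d E where *: "Sigma00 p" "set_env M E" "\<And>e. R e \<longleftrightarrow> l2_sat M (merge e d) E p"
    using assms by (auto simp: delta0_def)
  show ?thesis
    by (rule delta0I[of "FNeg p" M E _ d]) (simp_all add: * Sigma00.intros)
qed

lemma delta0_conj:
  assumes "delta0 M R" "delta0 M R'"
  shows "delta0 M (\<lambda>e. R e \<and> R' e)"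
proof (rule delta0_obtain2[OF assms])
  fix p p' d E
  assume *: "Sigma00 p" "Sigma00 p'" "set_env M E"
    "\<And>e. R e \<longleftrightarrow> l2_sat M (merge e d) E p" "\<And>e. R' e \<longleftrightarrow> l2_sat M (merge e d) E p'"
  show ?thesis
    by (rule delta0I[of "FAnd p p'" M E _ d]) (simp_all add: * Sigma00.intros)
qed

lemma delta0_disj:
  assumes "delta0 M R" "delta0 M R'"
  shows "delta0 M (\<lambda>e. R e \<or> R' e)"
  using delta0_not[OF delta0_conj[OF delta0_not[OF assms(1)] delta0_not[OF assms(2)]]] by simp

lemma delta0_imp:
  assumes "delta0 M R" "delta0 M R'"
  shows "delta0 M (\<lambda>e. R e \<longrightarrow> R' e)"
proof -
  have "(\<lambda>e. R e \<longrightarrow> R' e) = (\<lambda>e. \<not> R e \<or> R' e)" by blast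
  then show ?thesis by (simp only: delta0_disj delta0_not assms)
qed

lemma delta0_iff:
  assumes "delta0 M R" "delta0 M R'"
  shows "delta0 M (\<lambda>e. R e \<longleftrightarrow> R' e)"
proof -
  have "(\<lambda>e. R e \<longleftrightarrow> R' e) = (\<lambda>e. (R e \<longrightarrow> R' e) \<and> (R' e \<longrightarrow> R e))" by blast
  then show ?thesis by (simp only: delta0_conj delta0_imp assms)
qed

text \<open>
  To quantify over the argument 0, its variable moves to the parameter position 1, the other
  arguments move down by one, and \<open>shift_var\<close> or \<open>bind_var\<close> move all parameters up to make room.
\<close>

definition bind_var :: "nat \<Rightarrow> nat" where
  "bind_var n = (if n = 0 then 1 else if even n then n - 2 else n + 2)"

definition shift_var :: "nat \<Rightarrow> nat" where
  "shift_var n = (if even n then n else n + 2)"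

lemma inj_bind_var: "inj bind_var"
proof (rule inj_on_inverseI)
  fix n :: nat
  let ?g = "\<lambda>m :: nat. if m = 1 then 0 else if even m then m + 2 else m - 2"
  consider "n = 0" | "n \<noteq> 0" "even n" | "odd n" by blast
  then show "?g (bind_var n) = n"
  proof cases
    case 2
    then have "2 \<le> n" by presburger
    with 2 have "bind_var n + 2 = n" "even (bind_var n)" by (simp_all add: bind_var_def)
    then show ?thesis by auto
  next
    case 3
    then have "bind_var n = n + 2" using odd_pos[of n] by (simp add: bind_var_def)
    then show ?thesis using 3 odd_pos[of n] by simp
  qed (simp add: bind_var_def)
qed

lemma inj_shift_var: "inj shift_var"
  by (rule inj_on_inverseI[of _ "\<lambda>m. if even m then m else m - 2"]) (simp add: shift_var_def)

lemma merge_bind_var: "(merge e (case_nat c d))(1 := a) \<circ> bind_var = merge (case_nat a e) d"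
proof
  fix n
  show "((merge e (case_nat c d))(1 := a) \<circ> bind_var) n = merge (case_nat a e) d n"
  proof (cases "even n")
    case True
    then obtain m where "n = 2 * m" by (rule evenE)
    then show ?thesis by (cases m) (simp_all add: merge_def bind_var_def)
  next
    case False
    then obtain m where "n = 2 * m + 1" by (rule oddE)
    then show ?thesis by (simp add: merge_def bind_var_def)
  qed
qed

lemma merge_shift_var: "(merge e (case_nat c d))(1 := a) \<circ> shift_var = merge e d"
proof
  fix n
  show "((merge e (case_nat c d))(1 := a) \<circ> shift_var) n = merge e d n"
  proof (cases "even n")
    case True
    then obtain m where "n = 2 * m" by (rule evenE)
    then show ?thesis by (simp add: merge_def shift_var_def)
  next
    case False
    then obtain m where "n = 2 * m + 1" by (rule oddE)
    then show ?thesis by (simp add: merge_def shift_var_def)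
  qed
qed

text \<open>
  In this form the rule applies by higher-order pattern unification: below a quantifier, the bound
  variable becomes argument 0 and all other arguments are shifted.
\<close>

lemma delta0_all:
  assumes "delta0 M (\<lambda>e. Q (\<lambda>n. e (Suc n)) (e 0))" "delta0_term M f"
  shows "delta0 M (\<lambda>e. \<forall>y. NLess M y (f e) \<longrightarrow> Q e y)"
proof -
  obtain p t d E where 1: "Sigma00 p" "set_env M E"
      "\<And>e. Q (\<lambda>n. e (Suc n)) (e 0) \<longleftrightarrow> l2_sat M (merge e d) E p"
      "\<And>e. f e = term_val M (merge e d) t"
    using delta0_obtain_term[OF assms] by metis
  let ?p = "FAll 1 (FImp (FLess (TVar 1) (ren_term shift_var t)) (ren_formula bind_var id p))"
  show ?thesis unfolding delta0_def
  proof (intro exI conjI allI)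
    show "Sigma00 ?p"
      using 1(1) inj_bind_var
      by (intro Sigma00.intros Sigma00_ren) (auto simp: shift_var_def)
    show "set_env M E" by fact
    have Q: "Q e y \<longleftrightarrow> l2_sat M (merge (case_nat y e) d) E p" for e y
      using 1(3)[of "case_nat y e"] by simp
    show "(\<forall>y. NLess M y (f e) \<longrightarrow> Q e y) = l2_sat M (merge e (case_nat undefined d)) E ?p" for e
      unfolding l2_sat.simps l2_sat_ren[OF inj_bind_var] term_val_ren term_val.simps
        merge_bind_var merge_shift_var comp_id Q 1(4) by simp
  qed
qed

lemma delta0_ex:
  assumes "delta0 M (\<lambda>e. Q (\<lambda>n. e (Suc n)) (e 0))" "delta0_term M f"
  shows "delta0 M (\<lambda>e. \<exists>y. NLess M y (f e) \<and> Q e y)"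
  using delta0_not[OF delta0_all[of M "\<lambda>e y. \<not> Q e y", OF delta0_not[OF assms(1)] assms(2)]] by simp

locale l2_model =
  fixes M :: "'a l2_structure"
  assumes sets_nonempty: "SetPart M \<noteq> {}"
begin

lemma set_env_exists: "\<exists>E. set_env M E"
  using sets_nonempty by (auto simp: set_env_def)

lemma delta0_eq:
  assumes "delta0_term M f" "delta0_term M g"
  shows "delta0 M (\<lambda>e. f e = g e)"
proof (rule delta0_term_obtain2[OF assms])
  fix s t d
  assume *: "\<And>e. f e = term_val M (merge e d) s" "\<And>e. g e = term_val M (merge e d) t"
  obtain E where "set_env M E" using set_env_exists by blast
  then show ?thesis
    by (intro delta0I[of "FEq s t" M E _ d]) (simp_all add: * Sigma00.intros)
qed

lemma delta0_less:
  assumes "delta0_term M f" "delta0_term M g"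
  shows "delta0 M (\<lambda>e. NLess M (f e) (g e))"
proof (rule delta0_term_obtain2[OF assms])
  fix s t d
  assume *: "\<And>e. f e = term_val M (merge e d) s" "\<And>e. g e = term_val M (merge e d) t"
  obtain E where "set_env M E" using set_env_exists by blast
  then show ?thesis
    by (intro delta0I[of "FLess s t" M E _ d]) (simp_all add: * Sigma00.intros)
qed

lemma delta0_leq:
  assumes "delta0_term M f" "delta0_term M g"
  shows "delta0 M (\<lambda>e. NLeq M (f e) (g e))"
  unfolding NLeq_def by (intro delta0_disj delta0_less delta0_eq assms)

lemma delta0_mem:
  assumes "X \<in> SetPart M" "delta0_term M f"
  shows "delta0 M (\<lambda>e. f e \<in> X)"
proof -
  obtain t d where *: "\<And>e. f e = term_val M (merge e d) t"
    using assms(2) by (auto simp: delta0_term_def)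
  show ?thesis
    by (rule delta0I[of "FMem t 0" M "\<lambda>_. X" _ d]) (simp_all add: * Sigma00.intros set_env_def assms)
qed

lemma delta0_const: "delta0 M (\<lambda>e. b)"
proof (cases b)
  case True
  then show ?thesis using delta0_eq[OF delta0_term_const delta0_term_const, of undefined undefined] by simp
next
  case False
  then show ?thesis
    using delta0_not[OF delta0_eq[OF delta0_term_const delta0_term_const, of undefined undefined]] by simp
qed

lemmas delta0_intros =
  delta0_all delta0_ex delta0_not delta0_conj delta0_disj delta0_imp delta0_less delta0_leq
  delta0_mem delta0_eq delta0_iff delta0_const
  delta0_term_add delta0_term_mul delta0_term_exp delta0_term_pair delta0_term_var delta0_term_const

end

section \<open>Axioms of the theory\<close>

locale rca_star =
  fixes M :: "'a l2_structure"
  assumes models: "models_RCA0_star M"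

sublocale rca_star \<subseteq> l2_model
  using models by unfold_locales (simp add: models_RCA0_star_def)

context rca_star
begin

abbreviation zero :: 'a ("\<zero>") where "\<zero> \<equiv> NZero M"
abbreviation one :: 'a ("\<one>") where "\<one> \<equiv> NOne M"
abbreviation add :: "'a \<Rightarrow> 'a \<Rightarrow> 'a" (infixl "\<oplus>" 65) where "a \<oplus> b \<equiv> NAdd M a b"
abbreviation mul :: "'a \<Rightarrow> 'a \<Rightarrow> 'a" (infixl "\<otimes>" 70) where "a \<otimes> b \<equiv> NMul M a b"
abbreviation less :: "'a \<Rightarrow> 'a \<Rightarrow> bool" (infix "\<prec>" 50) where "a \<prec> b \<equiv> NLess M a b"
abbreviation leq :: "'a \<Rightarrow> 'a \<Rightarrow> bool" (infix "\<preceq>" 50) where "a \<preceq> b \<equiv> NLeq M a b"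
abbreviation pow2 :: "'a \<Rightarrow> 'a" where "pow2 a \<equiv> NExp M (\<one> \<oplus> \<one>) a"

lemma Suc_not_zero: "n \<oplus> \<one> \<noteq> \<zero>"
  and Suc_inject: "m \<oplus> \<one> = n \<oplus> \<one> \<Longrightarrow> m = n"
  and add_zero: "m \<oplus> \<zero> = m"
  and add_Suc: "m \<oplus> (n \<oplus> \<one>) = m \<oplus> n \<oplus> \<one>"
  and mul_zero: "m \<otimes> \<zero> = \<zero>"
  and mul_Suc: "m \<otimes> (n \<oplus> \<one>) = m \<otimes> n \<oplus> m"
  and not_less_zero: "\<not> m \<prec> \<zero>"
  and less_Suc_iff: "m \<prec> n \<oplus> \<one> \<longleftrightarrow> m \<prec> n \<or> m = n"
  and pow2_zero: "pow2 \<zero> = \<one>"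
  and pow2_Suc: "pow2 (n \<oplus> \<one>) = pow2 n \<otimes> (\<one> \<oplus> \<one>)"
  using models
  by (auto simp: models_RCA0_star_def basic_axioms_def exp_axioms_def NSuc_def)

lemma merge_upd_zero: "(merge e d)(0 := n) = merge (e(0 := n)) d"
  by (auto simp: merge_def fun_eq_iff)

lemma delta0_induct:
  assumes "delta0 M (\<lambda>e. P (e 0))" "P \<zero>" "\<And>n. P n \<Longrightarrow> P (n \<oplus> \<one>)"
  shows "P n"
proof -
  obtain p d E where p: "Sigma00 p" "set_env M E" "\<And>e. P (e 0) \<longleftrightarrow> l2_sat M (merge e d) E p"
    using assms(1) by (auto simp: delta0_def)
  have "induction_scheme M Sigma00"
    using models by (simp add: models_RCA0_star_def)
  then have "l2_sat M ((merge (\<lambda>_. \<zero>) d)(0 := \<zero>)) E p \<longrightarrow>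
      (\<forall>n. l2_sat M ((merge (\<lambda>_. \<zero>) d)(0 := n)) E p \<longrightarrow>
        l2_sat M ((merge (\<lambda>_. \<zero>) d)(0 := NSuc M n)) E p) \<longrightarrow>
      (\<forall>n. l2_sat M ((merge (\<lambda>_. \<zero>) d)(0 := n)) E p)"
    using p(1,2) unfolding induction_scheme_def by blast
  then show ?thesis
    unfolding merge_upd_zero p(3)[symmetric] using assms(2,3) by (auto simp: NSuc_def)
qed

text \<open>
  After \<open>shift_var\<close>, variable 1 does not occur in the formula, so that quantifying over it turns the
  same bounded formula into a \<open>\<Sigma>\<^sup>0\<^sub>1\<close> and into a \<open>\<Pi>\<^sup>0\<^sub>1\<close> one.
\<close>

lemma delta0_comprehension:
  assumes "delta0 M (\<lambda>e. P (e 0))"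
  shows "{n. P n} \<in> SetPart M"
proof -
  obtain p d E where p: "Sigma00 p" "set_env M E" "\<And>e. P (e 0) \<longleftrightarrow> l2_sat M (merge e d) E p"
    using assms(1) by (auto simp: delta0_def)
  let ?q = "ren_formula shift_var id p" and ?e = "merge (\<lambda>_. \<zero>) (case_nat \<zero> d)"
  have q: "Sigma00 ?q" using p(1) inj_shift_var by (rule Sigma00_ren)
  have sat: "l2_sat M ((?e(0 := n))(1 := a)) E ?q \<longleftrightarrow> P n" for n a
    unfolding merge_upd_zero l2_sat_ren[OF inj_shift_var] merge_shift_var comp_id p(3)[symmetric]
    by simp
  have "Delta01_comprehension M"
    using models by (simp add: models_RCA0_star_def)
  moreover have "Sigma01 (FEx 1 ?q)" "Pi01 (FAll 1 ?q)"
    using q by (auto simp: Sigma01_def Pi01_def)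
  moreover have "\<forall>n. l2_sat M (?e(0 := n)) E (FEx 1 ?q) \<longleftrightarrow> l2_sat M (?e(0 := n)) E (FAll 1 ?q)"
    unfolding l2_sat.simps sat by simp
  ultimately have "{n. l2_sat M (?e(0 := n)) E (FEx 1 ?q)} \<in> SetPart M"
    using p(2) unfolding Delta01_comprehension_def by blast
  then show ?thesis unfolding l2_sat.simps sat by simp
qed

section \<open>Arithmetic\<close>

lemma zero_add: "\<zero> \<oplus> n = n"
  by (rule delta0_induct[of "\<lambda>n. \<zero> \<oplus> n = n"])
    (intro delta0_intros | simp add: add_zero add_Suc)+

lemma Suc_add: "m \<oplus> \<one> \<oplus> n = m \<oplus> n \<oplus> \<one>"
  by (rule delta0_induct[of "\<lambda>n. m \<oplus> \<one> \<oplus> n = m \<oplus> n \<oplus> \<one>"])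
    (intro delta0_intros | simp add: add_zero add_Suc)+

lemma add_comm: "m \<oplus> n = n \<oplus> m"
  by (rule delta0_induct[of "\<lambda>n. m \<oplus> n = n \<oplus> m"])
    (intro delta0_intros | simp add: add_zero zero_add add_Suc Suc_add)+

lemma add_assoc: "a \<oplus> b \<oplus> c = a \<oplus> (b \<oplus> c)"
  by (rule delta0_induct[of "\<lambda>c. a \<oplus> b \<oplus> c = a \<oplus> (b \<oplus> c)"])
    (intro delta0_intros | simp add: add_zero add_Suc)+

lemma add_left_comm: "a \<oplus> (b \<oplus> c) = b \<oplus> (a \<oplus> c)"
  by (metis add_assoc add_comm)

lemma zero_mul: "\<zero> \<otimes> n = \<zero>"
  by (rule delta0_induct[of "\<lambda>n. \<zero> \<otimes> n = \<zero>"])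
    (intro delta0_intros | simp add: mul_zero mul_Suc add_zero)+

lemma Suc_mul: "(m \<oplus> \<one>) \<otimes> n = m \<otimes> n \<oplus> n"
proof (rule delta0_induct[of "\<lambda>n. (m \<oplus> \<one>) \<otimes> n = m \<otimes> n \<oplus> n"])
  show "delta0 M (\<lambda>e. (m \<oplus> \<one>) \<otimes> e 0 = m \<otimes> e 0 \<oplus> e 0)" by (intro delta0_intros)
  show "(m \<oplus> \<one>) \<otimes> (n \<oplus> \<one>) = m \<otimes> (n \<oplus> \<one>) \<oplus> (n \<oplus> \<one>)"
    if "(m \<oplus> \<one>) \<otimes> n = m \<otimes> n \<oplus> n" for n
    unfolding mul_Suc that by (simp add: add_assoc add_comm add_left_comm)
qed (simp add: mul_zero add_zero)

lemma mul_comm: "m \<otimes> n = n \<otimes> m"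
  by (rule delta0_induct[of "\<lambda>n. m \<otimes> n = n \<otimes> m"])
    (intro delta0_intros | simp add: mul_zero zero_mul mul_Suc Suc_mul)+

lemma add_mul: "(a \<oplus> b) \<otimes> c = a \<otimes> c \<oplus> b \<otimes> c"
proof (rule delta0_induct[of "\<lambda>c. (a \<oplus> b) \<otimes> c = a \<otimes> c \<oplus> b \<otimes> c"])
  show "delta0 M (\<lambda>e. (a \<oplus> b) \<otimes> e 0 = a \<otimes> e 0 \<oplus> b \<otimes> e 0)" by (intro delta0_intros)
  show "(a \<oplus> b) \<otimes> (n \<oplus> \<one>) = a \<otimes> (n \<oplus> \<one>) \<oplus> b \<otimes> (n \<oplus> \<one>)"
    if "(a \<oplus> b) \<otimes> n = a \<otimes> n \<oplus> b \<otimes> n" for n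
    unfolding mul_Suc that by (simp add: add_assoc add_comm add_left_comm)
qed (simp add: mul_zero add_zero)

lemma mul_assoc: "a \<otimes> b \<otimes> c = a \<otimes> (b \<otimes> c)"
proof (rule delta0_induct[of "\<lambda>c. a \<otimes> b \<otimes> c = a \<otimes> (b \<otimes> c)"])
  show "delta0 M (\<lambda>e. a \<otimes> b \<otimes> e 0 = a \<otimes> (b \<otimes> e 0))" by (intro delta0_intros)
  show "a \<otimes> b \<otimes> (n \<oplus> \<one>) = a \<otimes> (b \<otimes> (n \<oplus> \<one>))"
    if "a \<otimes> b \<otimes> n = a \<otimes> (b \<otimes> n)" for n
    unfolding mul_Suc that by (metis add_mul mul_comm)
qed (simp add: mul_zero)

lemma one_mul: "\<one> \<otimes> n = n"
  by (metis Suc_mul zero_add zero_mul)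

lemma add_cancel: "a \<oplus> c = b \<oplus> c \<Longrightarrow> a = b"
proof -
  have "a \<oplus> c = b \<oplus> c \<longrightarrow> a = b"
    by (rule delta0_induct[of "\<lambda>c. a \<oplus> c = b \<oplus> c \<longrightarrow> a = b"])
      (intro delta0_intros | simp add: add_zero add_Suc | blast dest: Suc_inject)+
  then show "a \<oplus> c = b \<oplus> c \<Longrightarrow> a = b" by blast
qed

lemma less_Suc: "n \<prec> n \<oplus> \<one>"
  by (simp add: less_Suc_iff)

lemma Suc_mono: "d \<prec> n \<Longrightarrow> d \<oplus> \<one> \<prec> n \<oplus> \<one>"
proof -
  have "d \<prec> n \<longrightarrow> d \<oplus> \<one> \<prec> n \<oplus> \<one>"
    by (rule delta0_induct[of "\<lambda>n. d \<prec> n \<longrightarrow> d \<oplus> \<one> \<prec> n \<oplus> \<one>"])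
      (intro delta0_intros | auto simp: not_less_zero less_Suc_iff)+
  then show "d \<prec> n \<Longrightarrow> d \<oplus> \<one> \<prec> n \<oplus> \<one>" by blast
qed

lemma less_add_Suc: "m \<prec> m \<oplus> (d \<oplus> \<one>)"
  by (rule delta0_induct[of "\<lambda>d. m \<prec> m \<oplus> (d \<oplus> \<one>)"])
    (intro delta0_intros | simp add: add_Suc add_zero zero_add less_Suc_iff)+

text \<open>The difference is bounded to keep the induction formula bounded.\<close>

lemma less_imp_add: "m \<prec> n \<Longrightarrow> \<exists>d. d \<prec> n \<and> n = m \<oplus> (d \<oplus> \<one>)"
proof -
  have "m \<prec> n \<longrightarrow> (\<exists>d. d \<prec> n \<and> n = m \<oplus> (d \<oplus> \<one>))"
  proof (rule delta0_induct[of "\<lambda>n. m \<prec> n \<longrightarrow> (\<exists>d. d \<prec> n \<and> n = m \<oplus> (d \<oplus> \<one>))"])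
    show "delta0 M (\<lambda>e. m \<prec> e 0 \<longrightarrow> (\<exists>d. d \<prec> e 0 \<and> e 0 = m \<oplus> (d \<oplus> \<one>)))"
      by (intro delta0_intros)
    show "m \<prec> \<zero> \<longrightarrow> (\<exists>d. d \<prec> \<zero> \<and> \<zero> = m \<oplus> (d \<oplus> \<one>))" by (simp add: not_less_zero)
    have zero_less_Suc: "\<zero> \<prec> n \<oplus> \<one>" for n
      by (metis less_add_Suc zero_add)
    show "m \<prec> n \<oplus> \<one> \<longrightarrow> (\<exists>d. d \<prec> n \<oplus> \<one> \<and> n \<oplus> \<one> = m \<oplus> (d \<oplus> \<one>))"
      if "m \<prec> n \<longrightarrow> (\<exists>d. d \<prec> n \<and> n = m \<oplus> (d \<oplus> \<one>))" for n
      using that zero_less_Suc unfolding less_Suc_iff[of m]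
      by (metis Suc_mono add_Suc zero_add)
  qed
  then show "m \<prec> n \<Longrightarrow> \<exists>d. d \<prec> n \<and> n = m \<oplus> (d \<oplus> \<one>)" by blast
qed

lemma less_iff_add: "m \<prec> n \<longleftrightarrow> (\<exists>d. n = m \<oplus> (d \<oplus> \<one>))"
  using less_imp_add less_add_Suc by blast

lemma less_irrefl: "\<not> n \<prec> n"
proof
  assume "n \<prec> n"
  then obtain d where "n = n \<oplus> (d \<oplus> \<one>)" by (auto simp: less_iff_add)
  then have "\<zero> \<oplus> n = d \<oplus> \<one> \<oplus> n" by (metis add_comm zero_add)
  then show False using add_cancel Suc_not_zero by metis
qed

lemma less_trans: "a \<prec> b \<Longrightarrow> b \<prec> c \<Longrightarrow> a \<prec> c"
  unfolding less_iff_add by (metis add_Suc add_assoc)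

lemma zero_or_Suc: "n = \<zero> \<or> (\<exists>d. d \<prec> n \<and> n = d \<oplus> \<one>)"
  by (rule delta0_induct[of "\<lambda>n. n = \<zero> \<or> (\<exists>d. d \<prec> n \<and> n = d \<oplus> \<one>)"])
    (intro delta0_intros | blast intro: less_Suc)+

lemma zero_less_Suc: "\<zero> \<prec> n \<oplus> \<one>"
  using less_add_Suc[of \<zero> n] by (simp only: zero_add)

lemma Suc_leI:
  assumes "n \<prec> m"
  shows "m = n \<oplus> \<one> \<or> n \<oplus> \<one> \<prec> m"
proof -
  obtain d where m: "m = n \<oplus> (d \<oplus> \<one>)" using assms less_iff_add by blast
  consider "d = \<zero>" | d' where "d = d' \<oplus> \<one>" using zero_or_Suc[of d] by blast
  then show ?thesis
  proof cases
    case 1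
    then show ?thesis by (simp only: m zero_add simp_thms)
  next
    case 2
    have "m = n \<oplus> \<one> \<oplus> (d' \<oplus> \<one>)"
      unfolding m 2 by (simp only: add_Suc Suc_add[of n d'])
    then show ?thesis by (simp only: less_add_Suc simp_thms)
  qed
qed

lemma less_linear: "m \<prec> n \<or> m = n \<or> n \<prec> m"
proof (rule delta0_induct[of "\<lambda>n. m \<prec> n \<or> m = n \<or> n \<prec> m"])
  show "delta0 M (\<lambda>e. m \<prec> e 0 \<or> m = e 0 \<or> e 0 \<prec> m)" by (intro delta0_intros)
  show "m \<prec> \<zero> \<or> m = \<zero> \<or> \<zero> \<prec> m"
    using zero_or_Suc[of m] zero_less_Suc by blast
  show "m \<prec> n \<oplus> \<one> \<or> m = n \<oplus> \<one> \<or> n \<oplus> \<one> \<prec> m" if "m \<prec> n \<or> m = n \<or> n \<prec> m" for n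
    using that Suc_leI[of n m] unfolding less_Suc_iff by blast
qed

text \<open>
  Truncated subtraction is the only operation that the type class of ordered semirings needs in
  addition to the language; with it, the class lemmas become available for the model.
\<close>

definition sub :: "'a \<Rightarrow> 'a \<Rightarrow> 'a" where
  "sub a b = (if b \<preceq> a then (THE d. b \<oplus> d = a) else \<zero>)"

lemma add_left_cancel: "c \<oplus> a = c \<oplus> b \<longleftrightarrow> a = b"
  by (metis add_cancel add_comm)

lemma leq_iff_add: "m \<preceq> n \<longleftrightarrow> (\<exists>d. m \<oplus> d = n)"
  unfolding NLeq_def less_iff_add by (metis add_zero zero_or_Suc)

lemma sub_eq: "b \<oplus> d = a \<Longrightarrow> sub a b = d"
proof -
  assume *: "b \<oplus> d = a"
  then have "b \<preceq> a" by (auto simp: leq_iff_add)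
  moreover have "(THE d. b \<oplus> d = a) = d"
    using * by (auto simp: add_left_cancel)
  ultimately show ?thesis by (simp add: sub_def)
qed

lemma sub_zero_case: "\<not> b \<preceq> a \<Longrightarrow> sub a b = \<zero>"
  by (simp add: sub_def)

lemma less_mul: "a \<prec> b \<Longrightarrow> \<zero> \<prec> c \<Longrightarrow> c \<otimes> a \<prec> c \<otimes> b"
proof -
  assume "a \<prec> b" "\<zero> \<prec> c"
  then obtain d c' where d: "b = a \<oplus> (d \<oplus> \<one>)" "c = c' \<oplus> \<one>"
    by (metis less_iff_add zero_add)
  have "c \<otimes> b = c \<otimes> a \<oplus> (c \<otimes> d \<oplus> c)"
    unfolding d(1) by (metis add_mul mul_comm mul_Suc)
  also have "c \<otimes> d \<oplus> c = c \<otimes> d \<oplus> c' \<oplus> \<one>" unfolding d(2) by (simp add: add_Suc)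
  finally show ?thesis by (auto simp: less_iff_add)
qed

lemma leq_trans: "a \<preceq> b \<Longrightarrow> b \<preceq> c \<Longrightarrow> a \<preceq> c"
  using less_trans by (auto simp: NLeq_def)

lemma sub_zero: "sub \<zero> c = \<zero>"
proof (cases "c \<preceq> \<zero>")
  case True
  then have "c = \<zero>" using not_less_zero by (auto simp: NLeq_def)
  then show ?thesis using sub_eq[OF add_zero] by simp
qed (rule sub_zero_case)

lemma sub_sub: "sub (sub a b) c = sub a (b \<oplus> c)"
proof (cases "b \<preceq> a")
  case True
  then obtain d where d: "b \<oplus> d = a" by (auto simp: leq_iff_add)
  show ?thesis
  proof (cases "c \<preceq> d")
    case True
    then obtain f where "c \<oplus> f = d" by (auto simp: leq_iff_add)
    then show ?thesis using sub_eq[OF d] sub_eq[of c f d] sub_eq[of "b \<oplus> c" f a] d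
      by (simp add: add_assoc)
  next
    case False
    then have "\<not> b \<oplus> c \<preceq> a"
      using d by (auto simp: leq_iff_add add_assoc add_left_cancel)
    then show ?thesis using sub_eq[OF d] False by (simp add: sub_zero_case)
  qed
next
  case False
  then have "\<not> b \<oplus> c \<preceq> a" by (auto simp: leq_iff_add add_assoc)
  then show ?thesis using False by (simp add: sub_zero_case sub_zero)
qed

end

sublocale rca_star \<subseteq> N: linordered_semidom
  "NAdd M" sub "NLeq M" "NLess M" "NZero M" "NMul M" "NOne M"
proof unfold_locales
  fix a b c
  show "a \<oplus> b \<oplus> c = a \<oplus> (b \<oplus> c)" by (rule add_assoc)
  show "a \<oplus> b = b \<oplus> a" by (rule add_comm)
  show "sub (a \<oplus> b) a = b" by (rule sub_eq) simp
  show "sub (sub a b) c = sub a (b \<oplus> c)" by (rule sub_sub)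
  show "a \<prec> b \<longleftrightarrow> a \<preceq> b \<and> \<not> b \<preceq> a"
    using less_irrefl less_trans by (auto simp: NLeq_def)
  show "a \<preceq> a" by (simp add: NLeq_def)
  show "a \<preceq> b \<Longrightarrow> b \<preceq> c \<Longrightarrow> a \<preceq> c" by (rule leq_trans)
  show "a \<preceq> b \<Longrightarrow> b \<preceq> a \<Longrightarrow> a = b"
    using less_irrefl less_trans by (auto simp: NLeq_def)
  show "a \<preceq> b \<or> b \<preceq> a" using less_linear by (auto simp: NLeq_def)
  show "a \<preceq> b \<Longrightarrow> c \<oplus> a \<preceq> c \<oplus> b"
    by (auto simp: leq_iff_add add_assoc)
  show "\<zero> \<oplus> a = a" by (rule zero_add)
  show "a \<otimes> b \<otimes> c = a \<otimes> (b \<otimes> c)" by (rule mul_assoc)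
  show "a \<otimes> b = b \<otimes> a" by (rule mul_comm)
  show "(a \<oplus> b) \<otimes> c = a \<otimes> c \<oplus> b \<otimes> c" by (rule add_mul)
  show "\<one> \<otimes> a = a" by (rule one_mul)
  show "\<zero> \<otimes> a = \<zero>" by (rule zero_mul)
  show "a \<prec> b \<Longrightarrow> \<zero> \<prec> c \<Longrightarrow> c \<otimes> a \<prec> c \<otimes> b" by (rule less_mul)
  show "a \<otimes> \<zero> = \<zero>" by (rule mul_zero)
  show "\<zero> \<noteq> \<one>" using Suc_not_zero[of \<zero>] by (simp add: zero_add)
  show "\<zero> \<prec> \<one>" using zero_less_Suc[of \<zero>] by (simp add: zero_add)
  show distrib: "a \<otimes> (b \<oplus> c) = a \<otimes> b \<oplus> a \<otimes> c" for a b c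
    by (simp only: mul_comm[of a] add_mul)
  have pos: "\<zero> \<prec> a" if "a \<noteq> \<zero>" for a
    using less_linear[of a \<zero>] that not_less_zero by blast
  show "a \<noteq> \<zero> \<Longrightarrow> b \<noteq> \<zero> \<Longrightarrow> a \<otimes> b \<noteq> \<zero>"
    using less_mul[OF pos pos, of b a] not_less_zero by (auto simp: mul_zero)
  show "b \<preceq> a \<Longrightarrow> sub a b \<oplus> b = a"
    unfolding leq_iff_add by (metis sub_eq add_comm)
  show "a \<otimes> sub b c = sub (a \<otimes> b) (a \<otimes> c)"
  proof (cases "c \<preceq> b")
    case True
    then obtain d where d: "c \<oplus> d = b" by (auto simp: leq_iff_add)
    show ?thesis
      using sub_eq[OF d] sub_eq[of "a \<otimes> c" "a \<otimes> d" "a \<otimes> b"] d distrib by metis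
  next
    case False
    then have *: "b \<prec> c" using less_linear[of b c] by (auto simp: NLeq_def)
    show ?thesis
    proof (cases "a = \<zero>")
      case True
      then show ?thesis by (simp add: zero_mul sub_zero)
    next
      case F: False
      have "\<not> a \<otimes> c \<preceq> a \<otimes> b"
        using less_mul[OF * pos[OF F]] less_irrefl less_trans by (auto simp: NLeq_def)
      then show ?thesis using False by (simp add: sub_zero_case mul_zero)
    qed
  qed
qed

context rca_star
begin

text \<open>The base of \<^term>\<open>pow2\<close> has to stay in the form in which its recursion equations mention it.\<close>

declare N.one_add_one [simp del]

lemma less_Suc_iff_leq: "m \<prec> n \<oplus> \<one> \<longleftrightarrow> m \<preceq> n"
  by (simp add: less_Suc_iff NLeq_def)

lemma Suc_leq_iff: "m \<oplus> \<one> \<preceq> n \<longleftrightarrow> m \<prec> n"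
  by (metis N.add_less_cancel_right N.not_less less_Suc_iff_leq)

lemma zero_leq [simp]: "\<zero> \<preceq> n"
  using not_less_zero N.not_less by blast

lemma pos_iff: "\<zero> \<prec> n \<longleftrightarrow> n \<noteq> \<zero>"
  using not_less_zero N.less_linear less_irrefl by metis

lemma leq_add1: "m \<preceq> m \<oplus> n" and leq_add2: "n \<preceq> m \<oplus> n"
  by (simp_all add: zero_leq)

text \<open>
  A term is substituted by quantifying over a new argument that is bounded by and equal to the value
  of the term; this way no substitution into formulas, with its capture conditions, has to be
  defined.
\<close>

lemma delta0_subst:
  assumes "delta0 M (\<lambda>e. R (\<lambda>n. e (Suc n)) (e 0))" "delta0_term M f"
  shows "delta0 M (\<lambda>e. R e (f e))"
proof -
  have "delta0 M (\<lambda>e. \<exists>y. y \<prec> f e \<oplus> \<one> \<and> y = f e \<and> R e y)"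
    by (intro delta0_intros assms(1,2) delta0_term_rename[OF assms(2)])
  then show ?thesis by (simp add: less_Suc cong: conj_cong)
qed

lemma delta0_subst1:
  assumes "delta0 M (\<lambda>e. R (e 0))" "delta0_term M f"
  shows "delta0 M (\<lambda>e. R (f e))"
  by (rule delta0_subst[of "\<lambda>e. R"]) fact+

lemma delta0_subst2:
  assumes R: "delta0 M (\<lambda>e. R (e 0) (e 1))" and f: "delta0_term M f" and g: "delta0_term M g"
  shows "delta0 M (\<lambda>e. R (f e) (g e))"
proof (rule delta0_subst[OF _ f])
  let ?h = "\<lambda>n. if n = 0 then 1 else if n = 1 then 0 else n :: nat"
  have "inj ?h" by (auto simp: inj_def)
  from delta0_rename[OF R this] have "delta0 M (\<lambda>e. R (e 1) (e 0))" by simp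
  then show "delta0 M (\<lambda>e. R (e 0) (g (\<lambda>n. e (Suc n))))"
    by - (rule delta0_subst[OF _ delta0_term_rename[OF g]], simp)
qed

lemma delta0_subst3:
  assumes R: "delta0 M (\<lambda>e. R (e 0) (e 1) (e 2))"
    and f: "delta0_term M f" and g: "delta0_term M g" and k: "delta0_term M k"
  shows "delta0 M (\<lambda>e. R (f e) (g e) (k e))"
proof (rule delta0_subst[OF _ f])
  let ?h = "\<lambda>n. if n = 0 then 2 else if n = 1 then 0 else if n = 2 then 1 else n :: nat"
  have "inj ?h" by (auto simp: inj_def)
  from delta0_rename[OF R this] have R': "delta0 M (\<lambda>e. R (e 2) (e 0) (e 1))" by simp
  have "delta0 M (\<lambda>e. R (e 1) (g (\<lambda>n. e (Suc (Suc n)))) (e 0))"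
  proof (rule delta0_subst[OF _ delta0_term_rename[OF g, of "\<lambda>n. Suc (Suc n)"]])
    show "delta0 M (\<lambda>e. R (e (Suc 1)) (e 0) (e (Suc 0)))"
      using R' by (simp add: numeral_2_eq_2)
  qed
  then have "delta0 M (\<lambda>e. R ((\<lambda>n. e (Suc n)) 0) (g (\<lambda>n. e (Suc (Suc n)))) (e 0))"
    by simp
  then show "delta0 M (\<lambda>e. R (e 0) (g (\<lambda>n. e (Suc n))) (k (\<lambda>n. e (Suc n))))"
    by (rule delta0_subst[OF _ delta0_term_rename[OF k], of "\<lambda>e. R (e 0) (g (\<lambda>n. e (Suc n)))"])
qed

lemma delta0_less_induct:
  assumes "delta0 M (\<lambda>e. P (e 0))" "\<And>n. (\<And>m. m \<prec> n \<Longrightarrow> P m) \<Longrightarrow> P n"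
  shows "P n"
proof -
  have "\<forall>m. m \<prec> n \<longrightarrow> P m"
  proof (rule delta0_induct[of "\<lambda>n. \<forall>m. m \<prec> n \<longrightarrow> P m"])
    show "delta0 M (\<lambda>e. \<forall>m. m \<prec> e 0 \<longrightarrow> P m)" by (intro delta0_intros assms(1))
  qed (auto simp: not_less_zero less_Suc_iff assms(2))
  then show ?thesis using assms(2) by blast
qed

lemma delta0_least:
  assumes "delta0 M (\<lambda>e. P (e 0))" "P n"
  shows "\<exists>m. P m \<and> (\<forall>k. k \<prec> m \<longrightarrow> \<not> P k)"
  using delta0_less_induct[of "\<lambda>n. \<not> P n", OF delta0_not[OF assms(1)]] assms(2) by blast

section \<open>Pairs\<close>

lemma pair_first_leq: "a \<preceq> NPair M a b" and pair_second_leq: "b \<preceq> NPair M a b"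
proof -
  have sq: "n \<preceq> n \<otimes> n" for n
    using N.mult_left_mono[of \<one> n n] zero_leq pos_iff Suc_leq_iff[of \<zero> n]
    by (cases "n = \<zero>") (auto simp: zero_leq)
  show "a \<preceq> NPair M a b" unfolding NPair_def by (rule leq_add2)
  have "b \<preceq> a \<oplus> b" by (rule leq_add2)
  also have "\<dots> \<preceq> (a \<oplus> b) \<otimes> (a \<oplus> b)" by (rule sq)
  also have "\<dots> \<preceq> NPair M a b" unfolding NPair_def by (rule leq_add1)
  finally show "b \<preceq> NPair M a b" .
qed

text \<open>A pair with sum \<open>s\<close> has a code of at least \<open>s\<^sup>2\<close> and below \<open>(s + 1)\<^sup>2\<close>.\<close>

lemma pair_sum_less:
  assumes "a \<oplus> b \<prec> c \<oplus> d"
  shows "NPair M a b \<prec> NPair M c d"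
proof -
  let ?s = "a \<oplus> b" and ?t = "c \<oplus> d"
  have "NPair M a b \<preceq> ?s \<otimes> ?s \<oplus> ?s"
    unfolding NPair_def by (simp add: zero_leq)
  also have "\<dots> \<prec> (?s \<oplus> \<one>) \<otimes> (?s \<oplus> \<one>)"
  proof -
    have "(?s \<oplus> \<one>) \<otimes> (?s \<oplus> \<one>) = ?s \<otimes> ?s \<oplus> ?s \<oplus> ?s \<oplus> \<one>"
      by (simp only: mul_Suc Suc_mul add_Suc)
    then show ?thesis by (simp add: less_Suc_iff_leq leq_add1)
  qed
  also have "\<dots> \<preceq> ?t \<otimes> ?t"
    using assms by (intro N.mult_mono) (simp_all add: Suc_leq_iff zero_leq)
  also have "\<dots> \<preceq> NPair M c d" unfolding NPair_def by (rule leq_add1)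
  finally show ?thesis .
qed

lemma pair_inject: "NPair M a b = NPair M c d \<longleftrightarrow> a = c \<and> b = d"
proof
  assume *: "NPair M a b = NPair M c d"
  then have sum: "a \<oplus> b = c \<oplus> d"
    using pair_sum_less[of a b c d] pair_sum_less[of c d a b] by (metis N.less_linear less_irrefl)
  then have "a = c" using * by (simp add: NPair_def)
  then show "a = c \<and> b = d" using sum by simp
qed simp

lemma pair_less: "a \<prec> c \<Longrightarrow> b \<preceq> d \<Longrightarrow> NPair M a b \<prec> NPair M c d"
  by (intro pair_sum_less N.add_less_le_mono)

section \<open>Finite sets coded by binary expansions\<close>

lemma pow2_pos: "\<zero> \<prec> pow2 n"
proof (rule delta0_induct[of "\<lambda>n. \<zero> \<prec> pow2 n"])
  show "delta0 M (\<lambda>e. \<zero> \<prec> pow2 (e 0))" by (intro delta0_intros)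
  show "\<zero> \<prec> pow2 n \<Longrightarrow> \<zero> \<prec> pow2 (n \<oplus> \<one>)" for n
    by (simp add: pow2_Suc pos_iff Suc_not_zero)
qed (simp add: pow2_zero)

lemma pow2_double: "pow2 (n \<oplus> \<one>) = pow2 n \<oplus> pow2 n"
  by (simp add: pow2_Suc algebra_simps)

lemma less_pow2: "n \<prec> pow2 n"
proof (rule delta0_induct[of "\<lambda>n. n \<prec> pow2 n"])
  show "delta0 M (\<lambda>e. e 0 \<prec> pow2 (e 0))" by (intro delta0_intros)
  show "n \<oplus> \<one> \<prec> pow2 (n \<oplus> \<one>)" if "n \<prec> pow2 n" for n
    unfolding pow2_double using that pow2_pos[of n] Suc_leq_iff[of \<zero> "pow2 n"]
    by (intro N.add_less_le_mono) simp_all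
qed (simp add: pow2_zero)

lemma pow2_add: "pow2 (m \<oplus> n) = pow2 m \<otimes> pow2 n"
proof (rule delta0_induct[of "\<lambda>n. pow2 (m \<oplus> n) = pow2 m \<otimes> pow2 n"])
  show "delta0 M (\<lambda>e. pow2 (m \<oplus> e 0) = pow2 m \<otimes> pow2 (e 0))" by (intro delta0_intros)
  show "pow2 (m \<oplus> (n \<oplus> \<one>)) = pow2 m \<otimes> pow2 (n \<oplus> \<one>)"
    if "pow2 (m \<oplus> n) = pow2 m \<otimes> pow2 n" for n
    by (simp only: add_Suc pow2_double that N.distrib_left)
qed (simp add: pow2_zero)

lemma pow2_mono: "m \<preceq> n \<Longrightarrow> pow2 m \<preceq> pow2 n"
proof -
  assume "m \<preceq> n"
  then obtain d where "n = m \<oplus> d" by (auto simp: leq_iff_add)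
  then show ?thesis
    using N.mult_left_mono[of \<one> "pow2 d" "pow2 m"] pow2_pos[of d] Suc_leq_iff[of \<zero> "pow2 d"]
    by (simp add: pow2_add zero_leq)
qed

lemma division_exists:
  assumes "\<zero> \<prec> d"
  shows "\<exists>q. q \<prec> t \<oplus> \<one> \<and> (\<exists>r. r \<prec> d \<and> t = q \<otimes> d \<oplus> r)"
proof (rule delta0_induct[of "\<lambda>t. \<exists>q. q \<prec> t \<oplus> \<one> \<and> (\<exists>r. r \<prec> d \<and> t = q \<otimes> d \<oplus> r)"])
  show "delta0 M (\<lambda>e. \<exists>q. q \<prec> e 0 \<oplus> \<one> \<and> (\<exists>r. r \<prec> d \<and> e 0 = q \<otimes> d \<oplus> r))"
    by (intro delta0_intros)
  show "\<exists>q. q \<prec> \<zero> \<oplus> \<one> \<and> (\<exists>r. r \<prec> d \<and> \<zero> = q \<otimes> d \<oplus> r)"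
    using assms by (intro exI[of _ \<zero>]) simp
  fix t assume "\<exists>q. q \<prec> t \<oplus> \<one> \<and> (\<exists>r. r \<prec> d \<and> t = q \<otimes> d \<oplus> r)"
  then obtain q r where q: "q \<prec> t \<oplus> \<one>" "r \<prec> d" "t = q \<otimes> d \<oplus> r" by blast
  show "\<exists>q. q \<prec> t \<oplus> \<one> \<oplus> \<one> \<and> (\<exists>r. r \<prec> d \<and> t \<oplus> \<one> = q \<otimes> d \<oplus> r)"
  proof (cases "r \<oplus> \<one> = d")
    case True
    have "t \<oplus> \<one> = (q \<oplus> \<one>) \<otimes> d \<oplus> \<zero>"
      using True by (simp add: q(3) Suc_mul add_assoc)
    then show ?thesis using q(1) assms by (intro exI[of _ "q \<oplus> \<one>"]) (auto intro: Suc_mono)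
  next
    case False
    then have "r \<oplus> \<one> \<prec> d" using Suc_leI[OF q(2)] by auto
    moreover have "t \<oplus> \<one> = q \<otimes> d \<oplus> (r \<oplus> \<one>)" by (simp add: q(3) add_assoc)
    ultimately show ?thesis using q(1) less_Suc_iff by blast
  qed
qed

lemma division_less: "q \<prec> q' \<Longrightarrow> r \<prec> d \<Longrightarrow> q \<otimes> d \<oplus> r \<prec> q' \<otimes> d \<oplus> r'"
proof -
  assume "q \<prec> q'" "r \<prec> d"
  then have "q \<otimes> d \<oplus> r \<prec> (q \<oplus> \<one>) \<otimes> d" by (simp add: Suc_mul)
  also have "\<dots> \<preceq> q' \<otimes> d"
    using \<open>q \<prec> q'\<close> by (intro N.mult_right_mono) (simp_all add: Suc_leq_iff zero_leq)
  also have "\<dots> \<preceq> q' \<otimes> d \<oplus> r'" by (rule leq_add1)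
  finally show ?thesis .
qed

lemma division_unique:
  assumes "q \<otimes> d \<oplus> r = q' \<otimes> d \<oplus> r'" "r \<prec> d" "r' \<prec> d"
  shows "q = q'" "r = r'"
proof -
  show q: "q = q'"
    using division_less[of q q' r d r'] division_less[of q' q r' d r] assms
    by (metis N.less_linear less_irrefl)
  show "r = r'" using assms(1) unfolding q by simp
qed

text \<open>
  \<open>low_bits t i r\<close> says that \<open>r\<close> is the remainder of \<open>t\<close> modulo the power \<open>pow2 i\<close>, and \<open>bit t i\<close>
  that the quotient is odd. Their quantifiers are bounded by \<open>t\<close> only to make them definable.
\<close>

definition low_bits :: "'a \<Rightarrow> 'a \<Rightarrow> 'a \<Rightarrow> bool" where
  "low_bits t i r \<longleftrightarrow> r \<prec> pow2 i \<and> (\<exists>q. q \<prec> t \<oplus> \<one> \<and> t = q \<otimes> pow2 i \<oplus> r)"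

definition bit :: "'a \<Rightarrow> 'a \<Rightarrow> bool" where
  "bit t i \<longleftrightarrow>
    (\<exists>q. q \<prec> t \<oplus> \<one> \<and> (\<exists>r. r \<prec> pow2 i \<and> t = (q \<oplus> q \<oplus> \<one>) \<otimes> pow2 i \<oplus> r))"

lemma delta0_low_bits:
  "delta0_term M f \<Longrightarrow> delta0_term M g \<Longrightarrow> delta0_term M h \<Longrightarrow>
    delta0 M (\<lambda>e. low_bits (f e) (g e) (h e))"
  by (rule delta0_subst3, unfold low_bits_def) (intro delta0_intros)

lemma delta0_bit:
  "delta0_term M f \<Longrightarrow> delta0_term M g \<Longrightarrow> delta0 M (\<lambda>e. bit (f e) (g e))"
  by (rule delta0_subst2, unfold bit_def) (intro delta0_intros)

lemma quotient_leq: "q \<preceq> q \<otimes> pow2 i \<oplus> r"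
proof -
  have "q \<otimes> \<one> \<preceq> q \<otimes> pow2 i"
    using pow2_pos[of i] Suc_leq_iff[of \<zero> "pow2 i"] by (intro N.mult_left_mono) (simp_all add: zero_leq)
  also have "\<dots> \<preceq> q \<otimes> pow2 i \<oplus> r" by (rule leq_add1)
  finally show ?thesis by simp
qed

lemma low_bits_iff: "low_bits t i r \<longleftrightarrow> r \<prec> pow2 i \<and> (\<exists>q. t = q \<otimes> pow2 i \<oplus> r)"
  unfolding low_bits_def by (metis less_Suc_iff_leq quotient_leq)

lemma bit_iff: "bit t i \<longleftrightarrow> (\<exists>q r. r \<prec> pow2 i \<and> t = (q \<oplus> q \<oplus> \<one>) \<otimes> pow2 i \<oplus> r)"
proof
  assume "\<exists>q r. r \<prec> pow2 i \<and> t = (q \<oplus> q \<oplus> \<one>) \<otimes> pow2 i \<oplus> r"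
  then obtain q r where qr: "r \<prec> pow2 i" "t = (q \<oplus> q \<oplus> \<one>) \<otimes> pow2 i \<oplus> r" by blast
  have "q \<preceq> q \<oplus> q \<oplus> \<one>" using leq_add1[of q "q \<oplus> \<one>"] by (simp add: add_assoc)
  also have "\<dots> \<preceq> t" unfolding qr(2) by (rule quotient_leq)
  finally show "bit t i" using qr unfolding bit_def less_Suc_iff_leq by blast
qed (auto simp: bit_def)

lemma low_bits_unique: "low_bits t i r \<Longrightarrow> low_bits t i r' \<Longrightarrow> r = r'"
  using division_unique(2) unfolding low_bits_iff by blast

lemma low_bits_exists: "\<exists>r. low_bits t i r"
  using division_exists[OF pow2_pos] unfolding low_bits_def by blast

lemma low_bits_self: "t \<prec> pow2 i \<Longrightarrow> low_bits t i t"
  unfolding low_bits_iff by (auto intro: exI[of _ \<zero>])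

lemma parity_exclusive: "q \<oplus> q \<noteq> p \<oplus> p \<oplus> \<one>"
proof
  assume "q \<oplus> q = p \<oplus> p \<oplus> \<one>"
  then have "q \<otimes> (\<one> \<oplus> \<one>) \<oplus> \<zero> = p \<otimes> (\<one> \<oplus> \<one>) \<oplus> \<one>" by (simp add: algebra_simps)
  then show False using division_unique(2)[of q "\<one> \<oplus> \<one>" \<zero> p \<one>] less_Suc[of \<one>] zero_less_Suc by auto
qed

lemma parity_cases: obtains p where "q = p \<oplus> p" | p where "q = p \<oplus> p \<oplus> \<one>"
proof -
  have "\<zero> \<prec> \<one> \<oplus> \<one>" by (rule zero_less_Suc)
  from division_exists[OF this, of q] obtain p r where "r \<prec> \<one> \<oplus> \<one>" "q = p \<otimes> (\<one> \<oplus> \<one>) \<oplus> r" by blast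
  moreover from this(1) have "r = \<zero> \<or> r = \<one>"
    using less_Suc_iff[of r \<one>] less_Suc_iff[of r \<zero>] not_less_zero by (auto simp: zero_add)
  ultimately show thesis using that by (auto simp: algebra_simps)
qed

lemma low_bits_Suc:
  assumes "low_bits t i r"
  shows "bit t i \<and> low_bits t (i \<oplus> \<one>) (r \<oplus> pow2 i) \<or> \<not> bit t i \<and> low_bits t (i \<oplus> \<one>) r"
proof -
  obtain q where q: "r \<prec> pow2 i" "t = q \<otimes> pow2 i \<oplus> r" using assms by (auto simp: low_bits_iff)
  have bit: "bit t i \<longleftrightarrow> (\<exists>p. q = p \<oplus> p \<oplus> \<one>)"
    unfolding bit_iff using division_unique(1)[of q "pow2 i" r] q by metis
  show ?thesis
  proof (cases q rule: parity_cases)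
    case (1 p)
    then have "\<not> bit t i" using parity_exclusive unfolding bit by metis
    moreover have "t = p \<otimes> pow2 (i \<oplus> \<one>) \<oplus> r"
      by (simp add: q(2) 1 pow2_double algebra_simps)
    moreover have "r \<prec> pow2 (i \<oplus> \<one>)"
      using q(1) leq_add1[of "pow2 i" "pow2 i"] unfolding pow2_double by (metis N.less_le_trans)
    ultimately show ?thesis by (auto simp: low_bits_iff)
  next
    case (2 p)
    then have "bit t i" unfolding bit by blast
    moreover have "t = p \<otimes> pow2 (i \<oplus> \<one>) \<oplus> (r \<oplus> pow2 i)"
      by (simp add: q(2) 2 pow2_double algebra_simps)
    moreover have "r \<oplus> pow2 i \<prec> pow2 (i \<oplus> \<one>)"
      using q(1) unfolding pow2_double by simp
    ultimately show ?thesis by (auto simp: low_bits_iff)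
  qed
qed

lemma bit_less: "bit t i \<Longrightarrow> i \<prec> t"
proof -
  assume "bit t i"
  then obtain q r where t: "t = (q \<oplus> q \<oplus> \<one>) \<otimes> pow2 i \<oplus> r" by (auto simp: bit_iff)
  have "pow2 i \<preceq> t" unfolding t Suc_mul using leq_add2 leq_add1 N.order_trans by blast
  then show "i \<prec> t" using less_pow2 N.less_le_trans by blast
qed

lemma not_bit_pow2: "t \<prec> pow2 a \<Longrightarrow> a \<preceq> i \<Longrightarrow> \<not> bit t i"
proof
  assume *: "t \<prec> pow2 a" "a \<preceq> i" "bit t i"
  then obtain q r where t: "t = (q \<oplus> q \<oplus> \<one>) \<otimes> pow2 i \<oplus> r" by (auto simp: bit_iff)
  have "pow2 i \<preceq> t" unfolding t Suc_mul using leq_add2 leq_add1 N.order_trans by blast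
  then show False using * pow2_mono N.less_le_trans N.not_less N.order_trans by metis
qed

text \<open>
  The remainders modulo the powers of two are compared by induction on the exponent. This makes
  inclusion-maximal sets accessible through numerically maximal codes.
\<close>

lemma bits_mono:
  assumes "\<And>i. bit s i \<Longrightarrow> bit t i"
  shows "s \<preceq> t"
proof -
  have "\<forall>r. r \<prec> pow2 i \<longrightarrow> (\<forall>r'. r' \<prec> pow2 i \<longrightarrow> low_bits s i r \<longrightarrow> low_bits t i r' \<longrightarrow> r \<preceq> r')" for i
  proof (rule delta0_induct[of "\<lambda>i. \<forall>r. r \<prec> pow2 i \<longrightarrow>
      (\<forall>r'. r' \<prec> pow2 i \<longrightarrow> low_bits s i r \<longrightarrow> low_bits t i r' \<longrightarrow> r \<preceq> r')"])
    show "delta0 M (\<lambda>e. \<forall>r. r \<prec> pow2 (e 0) \<longrightarrow>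
      (\<forall>r'. r' \<prec> pow2 (e 0) \<longrightarrow> low_bits s (e 0) r \<longrightarrow> low_bits t (e 0) r' \<longrightarrow> r \<preceq> r'))"
      by (intro delta0_low_bits delta0_intros)
    show "\<forall>r. r \<prec> pow2 \<zero> \<longrightarrow>
      (\<forall>r'. r' \<prec> pow2 \<zero> \<longrightarrow> low_bits s \<zero> r \<longrightarrow> low_bits t \<zero> r' \<longrightarrow> r \<preceq> r')"
      using less_Suc_iff[of _ \<zero>] by (auto simp: pow2_zero not_less_zero)
    fix i
    assume IH: "\<forall>r. r \<prec> pow2 i \<longrightarrow>
      (\<forall>r'. r' \<prec> pow2 i \<longrightarrow> low_bits s i r \<longrightarrow> low_bits t i r' \<longrightarrow> r \<preceq> r')"
    have "r \<preceq> r'" if r: "low_bits s (i \<oplus> \<one>) r" "low_bits t (i \<oplus> \<one>) r'" for r r'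
    proof -
      obtain u v where uv: "low_bits s i u" "low_bits t i v" using low_bits_exists by blast
      then have le: "u \<preceq> v" using IH by (auto simp: low_bits_iff)
      then have le': "u \<preceq> v \<oplus> pow2 i" "u \<oplus> pow2 i \<preceq> v \<oplus> pow2 i"
        using leq_add1 N.order_trans by (blast, simp)
      show ?thesis
        using low_bits_Suc[OF uv(1)] low_bits_Suc[OF uv(2)] assms[of i] le le'
          low_bits_unique[OF r(1)] low_bits_unique[OF r(2)] by metis
    qed
    then show "\<forall>r. r \<prec> pow2 (i \<oplus> \<one>) \<longrightarrow> (\<forall>r'. r' \<prec> pow2 (i \<oplus> \<one>) \<longrightarrow>
      low_bits s (i \<oplus> \<one>) r \<longrightarrow> low_bits t (i \<oplus> \<one>) r' \<longrightarrow> r \<preceq> r')" by blast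
  qed
  moreover have "s \<prec> pow2 (s \<oplus> t)" "t \<prec> pow2 (s \<oplus> t)"
    using less_pow2 pow2_mono leq_add1 leq_add2 N.less_le_trans by blast+
  ultimately show ?thesis using low_bits_self by blast
qed

text \<open>For \<open>i < a\<close>, adding \<open>pow2 a\<close> adds an even number to the quotient by \<open>pow2 i\<close>.\<close>

lemma bit_add_pow2:
  assumes "t \<prec> pow2 a" "i \<preceq> a"
  shows "bit (t \<oplus> pow2 a) i \<longleftrightarrow> bit t i \<or> i = a"
proof (cases "i = a")
  case True
  have "t \<oplus> pow2 a = (\<zero> \<oplus> \<zero> \<oplus> \<one>) \<otimes> pow2 a \<oplus> t" by (simp add: add_comm)
  then show ?thesis using assms(1) True unfolding bit_iff by blast
next
  case False
  then obtain d where d: "a = i \<oplus> (d \<oplus> \<one>)"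
    using \<open>i \<preceq> a\<close> by (auto simp: NLeq_def less_iff_add)
  obtain r q where q: "r \<prec> pow2 i" "t = q \<otimes> pow2 i \<oplus> r"
    using low_bits_exists[of t i] by (auto simp: low_bits_iff)
  let ?q = "q \<oplus> (pow2 d \<oplus> pow2 d)"
  have q': "t \<oplus> pow2 a = ?q \<otimes> pow2 i \<oplus> r"
    unfolding q(2) d pow2_add[of i "d \<oplus> \<one>"] pow2_double by (simp add: algebra_simps)
  have bit: "bit (p \<otimes> pow2 i \<oplus> r) i \<longleftrightarrow> (\<exists>u. p = u \<oplus> u \<oplus> \<one>)" for p
    unfolding bit_iff using division_unique(1)[of p "pow2 i" r] q by metis
  have "(\<exists>u. ?q = u \<oplus> u \<oplus> \<one>) \<longleftrightarrow> (\<exists>u. q = u \<oplus> u \<oplus> \<one>)"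
  proof (cases q rule: parity_cases)
    case (1 p)
    then have "?q = (p \<oplus> pow2 d) \<oplus> (p \<oplus> pow2 d)" by (simp add: algebra_simps)
    then show ?thesis using 1 parity_exclusive by metis
  next
    case (2 p)
    then have "?q = (p \<oplus> pow2 d) \<oplus> (p \<oplus> pow2 d) \<oplus> \<one>" by (simp add: algebra_simps)
    then show ?thesis using 2 by blast
  qed
  then have "bit (t \<oplus> pow2 a) i \<longleftrightarrow> bit t i"
    unfolding q' bit by (simp only: q(2) bit)
  then show ?thesis using False by simp
qed

text \<open>
  Bounded comprehension into numbers: the code is built bit by bit, and its bound \<open>pow2 a\<close> keeps
  the existence statement a bounded formula.
\<close>

lemma finite_set_code:
  assumes "delta0 M (\<lambda>e. P (e 0))"
  obtains s where "s \<prec> pow2 a" "\<And>i. bit s i \<longleftrightarrow> i \<prec> a \<and> P i"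
proof -
  have "\<exists>s. s \<prec> pow2 a \<and> (\<forall>i. i \<prec> a \<longrightarrow> (bit s i \<longleftrightarrow> P i))"
  proof (rule delta0_induct[of "\<lambda>a. \<exists>s. s \<prec> pow2 a \<and> (\<forall>i. i \<prec> a \<longrightarrow> (bit s i \<longleftrightarrow> P i))"])
    show "delta0 M (\<lambda>e. \<exists>s. s \<prec> pow2 (e 0) \<and> (\<forall>i. i \<prec> e 0 \<longrightarrow> (bit s i \<longleftrightarrow> P i)))"
      by (intro delta0_iff delta0_bit delta0_intros assms)
    show "\<exists>s. s \<prec> pow2 \<zero> \<and> (\<forall>i. i \<prec> \<zero> \<longrightarrow> (bit s i \<longleftrightarrow> P i))"
      using pow2_pos not_less_zero by blast
    fix a assume "\<exists>s. s \<prec> pow2 a \<and> (\<forall>i. i \<prec> a \<longrightarrow> (bit s i \<longleftrightarrow> P i))"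
    then obtain s where s: "s \<prec> pow2 a" "\<And>i. i \<prec> a \<Longrightarrow> bit s i \<longleftrightarrow> P i" by blast
    show "\<exists>s. s \<prec> pow2 (a \<oplus> \<one>) \<and> (\<forall>i. i \<prec> a \<oplus> \<one> \<longrightarrow> (bit s i \<longleftrightarrow> P i))"
    proof (cases "P a")
      case True
      have "s \<oplus> pow2 a \<prec> pow2 (a \<oplus> \<one>)" using s(1) by (simp add: pow2_double)
      moreover have "bit (s \<oplus> pow2 a) i \<longleftrightarrow> P i" if "i \<prec> a \<oplus> \<one>" for i
        using bit_add_pow2[OF s(1), of i] s(2)[of i] that True less_irrefl
        by (auto simp: less_Suc_iff NLeq_def)
      ultimately show ?thesis by blast
    next
      case False
      have "s \<prec> pow2 (a \<oplus> \<one>)"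
        using s(1) leq_add1 N.less_le_trans unfolding pow2_double by blast
      moreover have "\<not> bit s a" using s(1) not_bit_pow2 by blast
      ultimately show ?thesis using s(2) False by (auto simp: less_Suc_iff)
    qed
  qed
  then show thesis using that not_bit_pow2 by (metis N.not_less)
qed

section \<open>Codes of functions\<close>

lemma fun_app_iff:
  assumes "F \<in> fun_codes M A B" "x \<in> A"
  shows "fun_app M F x = y \<longleftrightarrow> NPair M x y \<in> F" "fun_app M F x \<in> B"
proof -
  have "\<exists>!y. y \<in> B \<and> NPair M x y \<in> F"
    using assms by (simp add: fun_codes_def)
  then obtain y' where y': "y' \<in> B" "NPair M x y' \<in> F"
    "\<And>y. y \<in> B \<Longrightarrow> NPair M x y \<in> F \<Longrightarrow> y = y'"
    by (elim ex1E) blast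
  have sub: "F \<subseteq> {NPair M x y | x y. x \<in> A \<and> y \<in> B}"
    using assms(1) by (simp add: fun_codes_def)
  have "y \<in> B" if "NPair M x y \<in> F" for y
  proof -
    from subsetD[OF sub that] obtain u v where "NPair M x y = NPair M u v" "v \<in> B" by blast
    then show ?thesis by (simp add: pair_inject)
  qed
  then have unique: "y = y'" if "NPair M x y \<in> F" for y using y'(3) that by simp
  then have app: "fun_app M F x = y'" unfolding fun_app_def using y'(2) by (intro the_equality)
  show "fun_app M F x = y \<longleftrightarrow> NPair M x y \<in> F"
    unfolding app using y'(2) unique[of y] by auto
  show "fun_app M F x \<in> B" unfolding app by (rule y'(1))
qed

lemma fun_code_exists:
  assumes \<Gamma>: "delta0 M (\<lambda>e. \<Gamma> (e 0) (e 1))"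
    and dom: "\<And>x y. \<Gamma> x y \<Longrightarrow> x \<in> A \<and> y \<in> B"
    and total: "\<And>x. x \<in> A \<Longrightarrow> \<exists>y. \<Gamma> x y"
    and unique: "\<And>x y y'. \<Gamma> x y \<Longrightarrow> \<Gamma> x y' \<Longrightarrow> y = y'"
  obtains F where "F \<in> fun_codes M A B" "\<And>x y. \<Gamma> x y \<Longrightarrow> fun_app M F x = y"
proof -
  define F where
    "F = {z. \<exists>x. x \<prec> z \<oplus> \<one> \<and> (\<exists>y. y \<prec> z \<oplus> \<one> \<and> (z = NPair M x y \<and> \<Gamma> x y))}"
  have "F \<in> SetPart M"
    unfolding F_def
    by (intro delta0_comprehension delta0_intros delta0_subst2[OF \<Gamma>])
  moreover have mem: "NPair M x y \<in> F \<longleftrightarrow> \<Gamma> x y" for x y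
    unfolding F_def
    by (auto simp: pair_inject less_Suc_iff_leq pair_first_leq pair_second_leq)
  moreover have "F \<subseteq> {NPair M x y | x y. x \<in> A \<and> y \<in> B}"
    using dom by (auto simp: F_def)
  moreover have "\<exists>!y. y \<in> B \<and> NPair M x y \<in> F" if "x \<in> A" for x
    using total[OF that] unique dom unfolding mem by blast
  ultimately have F: "F \<in> fun_codes M A B" by (simp add: fun_codes_def)
  moreover have "fun_app M F x = y" if "\<Gamma> x y" for x y
    using fun_app_iff(1)[OF F, of x y] mem[of x y] dom[OF that] that by simp
  ultimately show thesis by (rule that)
qed

section \<open>Repetition from multiple repetition\<close>

text \<open>Of two distinct places of the colour of \<open>x\<close>, at least one is not \<open>x\<close>.\<close>

lemma ERT_of_ERT_mult:
  assumes "ERT_mult M (\<one> \<oplus> \<one>)"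
  shows "ERT M"
  unfolding ERT_def
proof (intro allI ballI)
  fix k F assume "F \<in> fun_codes M UNIV (NBelow M k)"
  from bspec[OF spec[OF assms[unfolded ERT_mult_def]] this] obtain b where
    b: "\<forall>x. b \<preceq> x \<longrightarrow> (\<exists>G \<in> fun_codes M (NBelow M (\<one> \<oplus> \<one>)) UNIV.
      inj_on (fun_app M G) (NBelow M (\<one> \<oplus> \<one>)) \<and>
      (\<forall>i \<in> NBelow M (\<one> \<oplus> \<one>). b \<preceq> fun_app M G i \<and> fun_app M F (fun_app M G i) = fun_app M F x))"
    by (rule exE)
  show "\<exists>b. \<forall>x. b \<preceq> x \<longrightarrow> (\<exists>y. b \<preceq> y \<and> x \<noteq> y \<and> fun_app M F x = fun_app M F y)"
  proof (rule exI[of _ b], intro allI impI)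
    fix x assume "b \<preceq> x"
    from mp[OF spec[OF b] this] obtain G where G: "inj_on (fun_app M G) (NBelow M (\<one> \<oplus> \<one>))"
      "\<forall>i \<in> NBelow M (\<one> \<oplus> \<one>). b \<preceq> fun_app M G i \<and> fun_app M F (fun_app M G i) = fun_app M F x"
      by blast
    have mem: "\<zero> \<in> NBelow M (\<one> \<oplus> \<one>)" "\<one> \<in> NBelow M (\<one> \<oplus> \<one>)"
      by (auto simp: NBelow_def zero_less_Suc less_Suc)
    then have "fun_app M G \<zero> \<noteq> fun_app M G \<one>"
      using inj_on_eq_iff[OF G(1)] by simp
    then show "\<exists>y. b \<preceq> y \<and> x \<noteq> y \<and> fun_app M F x = fun_app M F y"
      using bspec[OF G(2) mem(1)] bspec[OF G(2) mem(2)] by (cases "fun_app M G \<zero> = x") auto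
  qed
qed

section \<open>Induction from repetition\<close>

text \<open>
  Here \<open>W w n\<close> says that \<open>w\<close> bounds witnesses for all \<open>m < n\<close>, so that \<open>W w (a + 1)\<close> fails for all
  \<open>w\<close>. \<open>J x n\<close> says that \<open>x\<close> is the least such bound for \<open>n\<close> but not yet a bound for \<open>n + 1\<close>; this is a
  one-to-one partial correspondence. Repetition for the colouring \<open>\<Gamma>\<close> forces \<open>J\<close> to stop at some \<open>b\<close>, but
  then \<open>b\<close> itself bounds witnesses for every \<open>n\<close>.
\<close>

lemma ERT_imp_induct:
  assumes "ERT M" and \<phi>: "delta0 M (\<lambda>e. \<phi> (e 0) (e 1))"
    and base: "\<exists>y. \<phi> \<zero> y" and step: "\<And>n. \<exists>y. \<phi> n y \<Longrightarrow> \<exists>y. \<phi> (n \<oplus> \<one>) y"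
  shows "\<exists>y. \<phi> a y"
proof (rule ccontr)
  assume a: "\<not> (\<exists>y. \<phi> a y)"
  define W where "W w n \<longleftrightarrow> (\<forall>m. m \<prec> n \<longrightarrow> (\<exists>y. y \<prec> w \<and> \<phi> m y))" for w n
  have W_mono: "W w n \<Longrightarrow> w \<preceq> w' \<Longrightarrow> n' \<preceq> n \<Longrightarrow> W w' n'" for w w' n n'
    unfolding W_def using N.less_le_trans by blast
  have W_zero: "W w \<zero>" for w by (simp add: W_def not_less_zero)
  have not_W: "\<not> W w (a \<oplus> \<one>)" for w using a less_Suc unfolding W_def by blast
  have W_Suc: "\<exists>w'. w \<preceq> w' \<and> W w' (n \<oplus> \<one>)" if W: "W w n" for w n
  proof -
    have "\<exists>y. \<phi> n y"
    proof (cases "n = \<zero>")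
      case False
      then obtain d where "d \<prec> n" "n = d \<oplus> \<one>" using zero_or_Suc[of n] by blast
      then show ?thesis using W step unfolding W_def by blast
    qed (use base in simp)
    then obtain y where y: "\<phi> n y" by blast
    have "w \<preceq> w \<oplus> (y \<oplus> \<one>)" "y \<prec> w \<oplus> (y \<oplus> \<one>)"
      using leq_add1 leq_add2 less_Suc N.less_le_trans by blast+
    moreover from this have "W (w \<oplus> (y \<oplus> \<one>)) (n \<oplus> \<one>)"
      using W y N.less_le_trans unfolding W_def less_Suc_iff by blast
    ultimately show ?thesis by blast
  qed
  have W: "delta0 M (\<lambda>e. W (f e) (g e))" if "delta0_term M f" "delta0_term M g" for f g
    by (rule delta0_subst2[OF _ that], unfold W_def) (intro delta0_intros delta0_subst2[OF \<phi>])
  define J where "J x n \<longleftrightarrow> W x n \<and> (\<forall>v. v \<prec> x \<longrightarrow> \<not> W v n) \<and> \<not> W x (n \<oplus> \<one>)" for x n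
  have J: "delta0 M (\<lambda>e. J (f e) (g e))" if "delta0_term M f" "delta0_term M g" for f g
    by (rule delta0_subst2[OF _ that], unfold J_def) (intro W delta0_intros)
  have J_unique: "n = n'" if "J x n" "J x n'" for x n n'
  proof (rule ccontr)
    assume "n \<noteq> n'"
    then have "n \<oplus> \<one> \<preceq> n' \<or> n' \<oplus> \<one> \<preceq> n"
      using N.less_linear[of n n'] by (simp add: Suc_leq_iff)
    then show False
      using that W_mono[of x n' x "n \<oplus> \<one>"] W_mono[of x n x "n' \<oplus> \<one>"] by (auto simp: J_def)
  qed
  have J_fun: "x = x'" if "J x n" "J x' n" for x x' n
    using that N.less_linear[of x x'] unfolding J_def by blast
  define \<Gamma> where "\<Gamma> x n \<longleftrightarrow>
    n \<prec> a \<oplus> \<one> \<and> J x n \<or> n = a \<oplus> \<one> \<and> (\<forall>m. m \<prec> a \<oplus> \<one> \<longrightarrow> \<not> J x m)" for x n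
  have "delta0 M (\<lambda>e. \<Gamma> (e 0) (e 1))" unfolding \<Gamma>_def by (intro J delta0_intros)
  moreover have "x \<in> UNIV \<and> n \<in> NBelow M (a \<oplus> \<one> \<oplus> \<one>)" if "\<Gamma> x n" for x n
    using that by (auto simp: \<Gamma>_def NBelow_def less_Suc_iff[of _ "a \<oplus> \<one>"])
  moreover have "\<exists>n. \<Gamma> x n" for x unfolding \<Gamma>_def by blast
  moreover have "n = n'" if "\<Gamma> x n" "\<Gamma> x n'" for x n n'
    using that J_unique unfolding \<Gamma>_def by blast
  ultimately obtain F where F: "F \<in> fun_codes M UNIV (NBelow M (a \<oplus> \<one> \<oplus> \<one>))"
    and app: "\<And>x n. \<Gamma> x n \<Longrightarrow> fun_app M F x = n"
    using fun_code_exists[of \<Gamma> UNIV "NBelow M (a \<oplus> \<one> \<oplus> \<one>)"] by blast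
  from bspec[OF spec[OF \<open>ERT M\<close>[unfolded ERT_def]] F] obtain b
    where b: "\<And>x. b \<preceq> x \<Longrightarrow> \<exists>y. b \<preceq> y \<and> x \<noteq> y \<and> fun_app M F x = fun_app M F y"
    by blast
  have no_J: "\<not> J x n" if "b \<preceq> x" for x n
  proof
    assume J: "J x n"
    have n: "n \<prec> a \<oplus> \<one>"
      using J not_W[of x] W_mono[of x n x "a \<oplus> \<one>"] N.not_less[of n "a \<oplus> \<one>"] by (auto simp: J_def)
    then have "\<Gamma> x n" using J by (simp add: \<Gamma>_def)
    then have "fun_app M F x = n" by (rule app)
    then obtain y where y: "x \<noteq> y" "fun_app M F y = n" using b[OF \<open>b \<preceq> x\<close>] by auto
    obtain n' where n': "\<Gamma> y n'" unfolding \<Gamma>_def by blast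
    then have "n' = n" using app y(2) by blast
    then have "J y n" using n' n less_irrefl by (auto simp: \<Gamma>_def)
    then show False using J_fun J y(1) by blast
  qed
  have "W b n" for n
  proof (rule delta0_induct[of "W b"])
    show "delta0 M (\<lambda>e. W b (e 0))" by (intro W delta0_intros)
    show "W b \<zero>" by (rule W_zero)
    fix n assume n: "W b n"
    show "W b (n \<oplus> \<one>)"
    proof (rule ccontr)
      assume not: "\<not> W b (n \<oplus> \<one>)"
      \<comment> \<open>The least bound for \<open>n + 1\<close> lies above \<open>b\<close>, and \<open>J\<close> relates it to the last \<open>m\<close> for
        which it is still a bound.\<close>
      obtain w' where w': "b \<preceq> w' \<and> W w' (n \<oplus> \<one>)" using W_Suc[OF n] by blast
      have "delta0 M (\<lambda>e. b \<preceq> e 0 \<and> W (e 0) (n \<oplus> \<one>))" by (intro W delta0_intros)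
      from delta0_least[of "\<lambda>w. b \<preceq> w \<and> W w (n \<oplus> \<one>)", OF this w']
      obtain w where w: "b \<preceq> w \<and> W w (n \<oplus> \<one>)"
        "\<And>v. v \<prec> w \<Longrightarrow> \<not> (b \<preceq> v \<and> W v (n \<oplus> \<one>))" by blast
      have min: "\<not> W v (n \<oplus> \<one>)" if "v \<prec> w" for v
        using w(2)[OF that] not W_mono[of v "n \<oplus> \<one>" b "n \<oplus> \<one>"] N.linear[of b v] by auto
      have "delta0 M (\<lambda>e. \<not> W w (e 0 \<oplus> \<one>))" by (intro W delta0_intros)
      from delta0_least[of "\<lambda>m. \<not> W w (m \<oplus> \<one>)", OF this not_W]
      obtain m where m: "\<not> W w (m \<oplus> \<one>)" "\<And>k. k \<prec> m \<Longrightarrow> W w (k \<oplus> \<one>)" by blast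
      have "W w m" using zero_or_Suc[of m] m(2) W_zero by auto
      have "n \<oplus> \<one> \<preceq> m"
        using m(1) w(1) W_mono[of w "n \<oplus> \<one>" w "m \<oplus> \<one>"] N.not_le[of "n \<oplus> \<one>" m]
        by (auto simp: Suc_leq_iff less_Suc_iff_leq)
      then have "\<not> W v m" if "v \<prec> w" for v
        using min[OF that] W_mono[of v m v "n \<oplus> \<one>"] by auto
      then have "J w m" using \<open>W w m\<close> m(1) by (simp add: J_def)
      then show False using no_J w(1) by blast
    qed
  qed
  then show False using not_W by blast
qed

text \<open>
  The assignment \<open>e\<close> of a given formula becomes its parameters. If \<open>x\<close> and \<open>y\<close> are the same
  variable, the second update wins on both sides.
\<close>

lemma delta0_sat:
  assumes "Sigma00 q" "set_env M E"
  shows "delta0 M (\<lambda>v. l2_sat M ((e(x := v 0))(y := v 1)) E q)"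
proof -
  let ?h = "\<lambda>n. if n = y then 2 else if n = x then 0 else 2 * n + 1"
  have "2 * n + 1 \<noteq> (2 :: nat)" for n by presburger
  then have "inj ?h"
    by (intro inj_on_inverseI[of _ "\<lambda>m. if m = 2 then y else if m = 0 then x else m div 2"]) simp
  moreover have "merge v e \<circ> ?h = (e(x := v 0))(y := v 1)" for v
    by (auto simp: merge_def fun_eq_iff)
  ultimately show ?thesis
    using assms by (intro delta0I[of "ren_formula ?h id q" M E _ e])
      (simp_all only: Sigma00_ren l2_sat_ren comp_id)
qed

lemma ISigma01_of_ERT:
  assumes "ERT M"
  shows "ISigma01 M"
  unfolding ISigma01_def induction_scheme_def
proof (intro allI impI)
  fix p x e E n
  assume p: "Sigma01 p" and E: "set_env M E" and base: "l2_sat M (e(x := \<zero>)) E p"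
    and step: "\<forall>n. l2_sat M (e(x := n)) E p \<longrightarrow> l2_sat M (e(x := NSuc M n)) E p"
  obtain y q where q: "Sigma00 q" "p = FEx y q" using p by (auto simp: Sigma01_def)
  let ?\<phi> = "\<lambda>n a. l2_sat M ((e(x := n))(y := a)) E q"
  have sat: "l2_sat M (e(x := n)) E p \<longleftrightarrow> (\<exists>a. ?\<phi> n a)" for n by (simp add: q(2))
  have "\<exists>a. ?\<phi> n a"
  proof (rule ERT_imp_induct[OF assms delta0_sat[OF q(1) E], of e x y])
    show "\<exists>a. ?\<phi> \<zero> a" using base unfolding sat .
    show "\<exists>a. ?\<phi> n a \<Longrightarrow> \<exists>a. ?\<phi> (n \<oplus> \<one>) a" for n
      using spec[OF step, of n] unfolding sat NSuc_def by (rule mp)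
  qed
  then show "l2_sat M (e(x := n)) E p" unfolding sat .
qed

text \<open>Argument 0 is the induction variable; argument 1, which is variable 2, is the witness.\<close>

lemma Sigma01_induct:
  assumes "ISigma01 M" and Q: "delta0 M (\<lambda>e. Q (e 0) (e 1))"
    and base: "\<exists>y. Q \<zero> y" and step: "\<And>n. \<exists>y. Q n y \<Longrightarrow> \<exists>y. Q (n \<oplus> \<one>) y"
  shows "\<exists>y. Q n y"
proof -
  obtain p d E where p: "Sigma00 p" "set_env M E"
      "\<And>e. Q (e 0) (e 1) \<longleftrightarrow> l2_sat M (merge e d) E p"
    using Q by (auto simp: delta0_def)
  let ?e = "merge (\<lambda>_. \<zero>) d"
  have "((?e(0 := n))(2 := a)) = merge (\<lambda>i. if i = 0 then n else if i = 1 then a else \<zero>) d" for n a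
    by (auto simp: merge_def fun_eq_iff)
  then have sat: "l2_sat M (?e(0 := n)) E (FEx 2 p) \<longleftrightarrow> (\<exists>y. Q n y)" for n
    by (simp flip: p(3))
  have "Sigma01 (FEx 2 p)" using p(1) by (auto simp: Sigma01_def)
  then have "l2_sat M (?e(0 := n)) E (FEx 2 p)"
  proof (rule assms(1)[unfolded ISigma01_def induction_scheme_def, rule_format, OF _ p(2)])
    show "l2_sat M (?e(0 := \<zero>)) E (FEx 2 p)" unfolding sat by (rule base)
    show "l2_sat M (?e(0 := n)) E (FEx 2 p) \<Longrightarrow> l2_sat M (?e(0 := NSuc M n)) E (FEx 2 p)" for n
      unfolding sat NSuc_def by (rule step)
  qed
  then show ?thesis unfolding sat .
qed

section \<open>Multiple repetition from repetition\<close>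

lemma delta0_app:
  assumes "F \<in> fun_codes M UNIV B" "delta0_term M s" "delta0_term M t"
  shows "delta0 M (\<lambda>e. fun_app M F (s e) = t e)"
proof -
  have "F \<in> SetPart M" using assms(1) by (simp add: fun_codes_def)
  then show ?thesis
    unfolding fun_app_iff(1)[OF assms(1) UNIV_I]
    by (intro delta0_mem delta0_term_pair assms(2,3))
qed

lemma delta0_app_eq:
  assumes F: "F \<in> fun_codes M UNIV (NBelow M k)" and s: "delta0_term M s" and t: "delta0_term M t"
  shows "delta0 M (\<lambda>e. fun_app M F (s e) = fun_app M F (t e))"
proof -
  have "fun_app M F x = fun_app M F y \<longleftrightarrow>
      (\<exists>c. c \<prec> k \<and> (fun_app M F x = c \<and> fun_app M F y = c))" for x y
    using fun_app_iff(2)[OF F, of y] by (auto simp: NBelow_def)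
  moreover have "delta0 M (\<lambda>e. \<exists>c. c \<prec> k \<and> (fun_app M F (e 0) = c \<and> fun_app M F (e 1) = c))"
    by (intro delta0_ex delta0_conj delta0_app[OF F] delta0_term_var delta0_term_const)
  ultimately have "delta0 M (\<lambda>e. fun_app M F (e 0) = fun_app M F (e 1))" by (simp only:)
  then show ?thesis using s t by (rule delta0_subst2)
qed

text \<open>
  Recursion along a definable predecessor relation for functions with a bounded range. The values
  below \<open>n\<close> form a finite set of pairs with a code below \<open>pow2 (NPair M n j)\<close>; this bound makes the
  existence of partial solutions a matter of bounded induction, and lets a bounded formula define
  their union. Partial solutions agree where both are defined, by course-of-values induction.
\<close>

lemma bounded_recursion:
  assumes Pr: "delta0 M (\<lambda>e. Pr (e 0) (e 1))" and S: "delta0 M (\<lambda>e. S (e 0) (e 1))"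
    and Pr_less: "\<And>z x. Pr z x \<Longrightarrow> z \<prec> x"
    and Pr_unique: "\<And>z z' x. Pr z x \<Longrightarrow> Pr z' x \<Longrightarrow> z = z'"
    and S_total: "\<And>i. i \<prec> j \<Longrightarrow> \<exists>i'. i' \<prec> j \<and> S i i'"
    and S_unique: "\<And>i i' i''. S i i' \<Longrightarrow> S i i'' \<Longrightarrow> i' = i''"
    and c: "c \<prec> j"
  obtains P where "P \<in> fun_codes M UNIV (NBelow M j)"
    "\<And>x. (\<And>z. \<not> Pr z x) \<Longrightarrow> fun_app M P x = c"
    "\<And>z x. Pr z x \<Longrightarrow> S (fun_app M P z) (fun_app M P x)"
proof -
  \<comment> \<open>\<open>t\<close> codes a graph, \<open>loc t x i\<close> is the recursion equation for the value \<open>i\<close> at \<open>x\<close>, and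
    \<open>cor t n\<close> says that \<open>t\<close> solves it below \<open>n\<close>.\<close>
  define val where "val t y i \<longleftrightarrow> bit t (NPair M y i)" for t y i
  define loc where "loc t x i \<longleftrightarrow> i = c \<and> (\<forall>z. z \<prec> x \<longrightarrow> \<not> Pr z x) \<or>
    (\<exists>z. z \<prec> x \<and> (Pr z x \<and> (\<exists>i'. i' \<prec> j \<and> (val t z i' \<and> S i' i))))" for t x i
  define cor where "cor t n \<longleftrightarrow>
    (\<forall>y. y \<prec> n \<longrightarrow> (\<forall>i. i \<prec> j \<longrightarrow> (val t y i \<longleftrightarrow> loc t y i)))" for t n
  have val: "delta0 M (\<lambda>e. val (f e) (g e) (h e))"
    if "delta0_term M f" "delta0_term M g" "delta0_term M h" for f g h
    unfolding val_def by (intro delta0_bit delta0_term_pair that)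
  have loc: "delta0 M (\<lambda>e. loc (f e) (g e) (h e))"
    if "delta0_term M f" "delta0_term M g" "delta0_term M h" for f g h
    by (rule delta0_subst3[OF _ that], unfold loc_def)
      (intro val delta0_subst2[OF Pr] delta0_subst2[OF S] delta0_intros)
  have cor: "delta0 M (\<lambda>e. cor (f e) (g e))" if "delta0_term M f" "delta0_term M g" for f g
    by (rule delta0_subst2[OF _ that], unfold cor_def) (intro val loc delta0_iff delta0_intros)
  have loc_cong: "loc t x i \<longleftrightarrow> loc t' x i"
    if "\<And>z i. z \<prec> x \<Longrightarrow> i \<prec> j \<Longrightarrow> val t z i \<longleftrightarrow> val t' z i" for t t' x i
    unfolding loc_def using that by blast
  have cor_exists: "\<exists>t. t \<prec> pow2 (NPair M n j) \<and> cor t n" for n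
  proof (rule delta0_induct[of "\<lambda>n. \<exists>t. t \<prec> pow2 (NPair M n j) \<and> cor t n"])
    show "delta0 M (\<lambda>e. \<exists>t. t \<prec> pow2 (NPair M (e 0) j) \<and> cor t (e 0))"
      by (intro cor delta0_intros)
    show "\<exists>t. t \<prec> pow2 (NPair M \<zero> j) \<and> cor t \<zero>"
      using pow2_pos not_less_zero unfolding cor_def by blast
    fix n assume "\<exists>t. t \<prec> pow2 (NPair M n j) \<and> cor t n"
    then obtain t where t: "cor t n" by blast
    define X where "X u \<longleftrightarrow> (\<exists>y. y \<prec> n \<and> (\<exists>i. i \<prec> j \<and> (u = NPair M y i \<and> val t y i))) \<or>
      (\<exists>i. i \<prec> j \<and> (u = NPair M n i \<and> loc t n i))" for u
    have "delta0 M (\<lambda>e. X (e 0))" unfolding X_def by (intro val loc delta0_intros)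
    then obtain t' where t': "t' \<prec> pow2 (NPair M (n \<oplus> \<one>) j)"
        "\<And>u. bit t' u \<longleftrightarrow> u \<prec> NPair M (n \<oplus> \<one>) j \<and> X u"
      using finite_set_code[of X "NPair M (n \<oplus> \<one>) j"] by metis
    have val': "val t' y i \<longleftrightarrow> X (NPair M y i)" if "y \<preceq> n" "i \<prec> j" for y i
      using pair_less[of y "n \<oplus> \<one>" i j] that
      by (simp add: val_def t'(2) less_Suc_iff_leq N.less_imp_le)
    have old: "val t' y i \<longleftrightarrow> val t y i" if "y \<prec> n" "i \<prec> j" for y i
      using that less_irrefl by (auto simp: val' N.less_imp_le X_def pair_inject)
    have new: "val t' n i \<longleftrightarrow> loc t n i" if "i \<prec> j" for i
      using that less_irrefl by (auto simp: val' X_def pair_inject)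
    have "loc t' y i \<longleftrightarrow> loc t y i" if "y \<preceq> n" for y i
      using old that N.less_le_trans by (intro loc_cong) blast
    then have "cor t' (n \<oplus> \<one>)"
      using t old new by (simp add: cor_def less_Suc_iff NLeq_def)
    then show "\<exists>t. t \<prec> pow2 (NPair M (n \<oplus> \<one>) j) \<and> cor t (n \<oplus> \<one>)" using t'(1) by blast
  qed
  have val_iff: "val t y i \<longleftrightarrow> loc t y i" if "cor t n" "y \<prec> n" "i \<prec> j" for t n y i
    using that unfolding cor_def by blast
  have val_unique: "\<exists>i. i \<prec> j \<and> (val t y i \<and> (\<forall>i'. i' \<prec> j \<longrightarrow> val t y i' \<longrightarrow> i' = i))"
    if "cor t n" "y \<prec> n" for t n y
  proof -
    have "y \<prec> n \<longrightarrow> (\<exists>i. i \<prec> j \<and> (val t y i \<and> (\<forall>i'. i' \<prec> j \<longrightarrow> val t y i' \<longrightarrow> i' = i)))" (is "?P y")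
    proof (rule delta0_less_induct[of ?P])
      show "delta0 M (\<lambda>e. ?P (e 0))" by (intro val delta0_intros)
      fix y assume IH: "\<And>z. z \<prec> y \<Longrightarrow> ?P z"
      show "?P y"
      proof
        assume y: "y \<prec> n"
        show "\<exists>i. i \<prec> j \<and> (val t y i \<and> (\<forall>i'. i' \<prec> j \<longrightarrow> val t y i' \<longrightarrow> i' = i))"
        proof (cases "\<exists>z. Pr z y")
          case True
          then obtain z where z: "Pr z y" by blast
          then have "z \<prec> y" by (rule Pr_less)
          moreover from this y have "z \<prec> n" by (rule less_trans)
          ultimately obtain i where i: "i \<prec> j" "val t z i" "\<And>i'. i' \<prec> j \<Longrightarrow> val t z i' \<Longrightarrow> i' = i"
            using IH by blast
          obtain i' where i': "i' \<prec> j" "S i i'" using S_total[OF i(1)] by blast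
          have loc_y: "loc t y u \<longleftrightarrow> S i u" for u
          proof
            assume "loc t y u"
            then obtain z' v where "Pr z' y" "v \<prec> j" "val t z' v" "S v u"
              using z \<open>z \<prec> y\<close> unfolding loc_def by blast
            then show "S i u" using Pr_unique[OF z] i(3) by blast
          next
            assume "S i u"
            then show "loc t y u" using z \<open>z \<prec> y\<close> i(1,2) unfolding loc_def by blast
          qed
          show ?thesis
            using i' S_unique[OF i'(2)] val_iff[OF that(1) y] loc_y by metis
        next
          case False
          then have "loc t y u \<longleftrightarrow> u = c" for u unfolding loc_def by blast
          then show ?thesis using c val_iff[OF that(1) y] by metis
        qed
      qed
    qed
    then show ?thesis using that(2) by blast
  qed
  have agree: "val t y i \<longleftrightarrow> val t' y i"
    if t: "cor t n" "cor t' n'" and y: "y \<prec> n" "y \<prec> n'" "i \<prec> j" for t t' n n' y i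
  proof -
    have "y \<prec> n \<longrightarrow> y \<prec> n' \<longrightarrow> (\<forall>i. i \<prec> j \<longrightarrow> (val t y i \<longleftrightarrow> val t' y i))" (is "?P y")
    proof (rule delta0_less_induct[of ?P])
      show "delta0 M (\<lambda>e. ?P (e 0))" by (intro val delta0_iff delta0_intros)
      fix y assume IH: "\<And>z. z \<prec> y \<Longrightarrow> ?P z"
      show "?P y"
      proof (intro impI allI)
        fix i assume y: "y \<prec> n" "y \<prec> n'" "i \<prec> j"
        have "loc t y i \<longleftrightarrow> loc t' y i"
          by (rule loc_cong) (use IH y less_trans in blast)
        then show "val t y i \<longleftrightarrow> val t' y i"
          using val_iff[OF t(1) y(1,3)] val_iff[OF t(2) y(2,3)] by simp
      qed
    qed
    then show ?thesis using y by blast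
  qed
  define \<Gamma> where "\<Gamma> x i \<longleftrightarrow>
    i \<prec> j \<and> (\<exists>t. t \<prec> pow2 (NPair M (x \<oplus> \<one>) j) \<and> (cor t (x \<oplus> \<one>) \<and> val t x i))" for x i
  have \<Gamma>_iff: "\<Gamma> x i \<longleftrightarrow> i \<prec> j \<and> val t x i" if "cor t n" "x \<prec> n" for t n x i
  proof
    assume "\<Gamma> x i"
    then show "i \<prec> j \<and> val t x i"
      using agree[OF that(1) _ that(2) less_Suc] unfolding \<Gamma>_def by blast
  next
    assume i: "i \<prec> j \<and> val t x i"
    obtain t' where "t' \<prec> pow2 (NPair M (x \<oplus> \<one>) j)" "cor t' (x \<oplus> \<one>)"
      using cor_exists by blast
    then show "\<Gamma> x i"
      using agree[OF that(1) _ that(2) less_Suc, of t' i] i unfolding \<Gamma>_def by blast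
  qed
  have "delta0 M (\<lambda>e. \<Gamma> (e 0) (e 1))" unfolding \<Gamma>_def by (intro cor val delta0_intros)
  moreover have "x \<in> UNIV \<and> i \<in> NBelow M j" if "\<Gamma> x i" for x i
    using that by (simp add: \<Gamma>_def NBelow_def)
  moreover have \<Gamma>_ex: "\<exists>i. \<Gamma> x i" and "\<Gamma> x i \<Longrightarrow> \<Gamma> x i' \<Longrightarrow> i = i'" for x i i'
  proof -
    obtain t where t: "cor t (x \<oplus> \<one>)" using cor_exists by blast
    show "\<exists>i. \<Gamma> x i" "\<Gamma> x i \<Longrightarrow> \<Gamma> x i' \<Longrightarrow> i = i'"
      using val_unique[OF t less_Suc] unfolding \<Gamma>_iff[OF t less_Suc] by blast+
  qed
  ultimately obtain P where P: "P \<in> fun_codes M UNIV (NBelow M j)"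
    and app: "\<And>x i. \<Gamma> x i \<Longrightarrow> fun_app M P x = i"
    using fun_code_exists[of \<Gamma> UNIV "NBelow M j"] by blast
  have loc_app: "\<exists>t. loc t x (fun_app M P x) \<and> (\<forall>z i. z \<prec> x \<longrightarrow> i \<prec> j \<longrightarrow> val t z i \<longrightarrow> fun_app M P z = i)" for x
  proof -
    obtain t where t: "cor t (x \<oplus> \<one>)" using cor_exists by blast
    have "\<Gamma> x (fun_app M P x)" using \<Gamma>_ex[of x] app by blast
    then have "loc t x (fun_app M P x)"
      using val_iff[OF t less_Suc] unfolding \<Gamma>_iff[OF t less_Suc] by blast
    moreover have "fun_app M P z = i" if "z \<prec> x" "i \<prec> j" "val t z i" for z i
    proof -
      have "z \<prec> x \<oplus> \<one>" using that(1) by (simp add: less_Suc_iff)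
      then show ?thesis using app \<Gamma>_iff[OF t] that by blast
    qed
    ultimately show ?thesis by blast
  qed
  show thesis
  proof (rule that[OF P])
    show "fun_app M P x = c" if "\<And>z. \<not> Pr z x" for x
      using loc_app[of x] that unfolding loc_def by blast
    show "S (fun_app M P z) (fun_app M P x)" if zx: "Pr z x" for z x
    proof -
      obtain t where t: "loc t x (fun_app M P x)"
        "\<And>z i. z \<prec> x \<Longrightarrow> i \<prec> j \<Longrightarrow> val t z i \<Longrightarrow> fun_app M P z = i"
        using loc_app[of x] by blast
      then obtain z' i' where z': "z' \<prec> x" "Pr z' x" "i' \<prec> j" "val t z' i'" "S i' (fun_app M P x)"
        using zx Pr_less[OF zx] unfolding loc_def by blast
      have "z' = z" using Pr_unique[OF z'(2) zx] .
      then show ?thesis using z' t(2)[OF z'(1,3,4)] by simp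
    qed
  qed
qed

definition cyclic_next :: "'a \<Rightarrow> 'a \<Rightarrow> 'a" where
  "cyclic_next j i = (if i \<oplus> \<one> \<prec> j then i \<oplus> \<one> else \<zero>)"

text \<open>Steps lead from \<open>r\<close> up to \<open>j - 1\<close>, from there to \<open>0\<close>, and from \<open>0\<close> to everything below \<open>j\<close>.\<close>

lemma cyclic_orbit_all:
  assumes H: "delta0 M (\<lambda>e. H (e 0))" and r: "H r" "r \<prec> j"
    and step: "\<And>i. i \<prec> j \<Longrightarrow> H i \<Longrightarrow> H (cyclic_next j i)" and i: "i \<prec> j"
  shows "H i"
proof -
  have up: "i \<oplus> d \<prec> j \<longrightarrow> H (i \<oplus> d)" if "H i" for i d
  proof (rule delta0_induct[of "\<lambda>d. i \<oplus> d \<prec> j \<longrightarrow> H (i \<oplus> d)"])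
    show "delta0 M (\<lambda>e. i \<oplus> e 0 \<prec> j \<longrightarrow> H (i \<oplus> e 0))"
      by (intro delta0_intros delta0_subst1[OF H])
    show "i \<oplus> \<zero> \<prec> j \<longrightarrow> H (i \<oplus> \<zero>)" using that by simp
    fix d assume IH: "i \<oplus> d \<prec> j \<longrightarrow> H (i \<oplus> d)"
    show "i \<oplus> (d \<oplus> \<one>) \<prec> j \<longrightarrow> H (i \<oplus> (d \<oplus> \<one>))"
    proof
      assume *: "i \<oplus> (d \<oplus> \<one>) \<prec> j"
      then have "i \<oplus> d \<oplus> \<one> \<prec> j" by (simp only: add_Suc)
      moreover from this have "i \<oplus> d \<prec> j" using less_Suc less_trans by blast
      ultimately show "H (i \<oplus> (d \<oplus> \<one>))"
        using IH step[of "i \<oplus> d"] by (simp add: cyclic_next_def add_Suc)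
    qed
  qed
  obtain l where l: "j = l \<oplus> \<one>" using zero_or_Suc[of j] i not_less_zero by blast
  then have "r \<preceq> l" using r(2) by (simp add: less_Suc_iff_leq)
  then obtain d where "r \<oplus> d = l" by (auto simp: leq_iff_add)
  then have "H l" using up[OF r(1), of d] l less_Suc by auto
  then have "H \<zero>" using step[of l] l less_Suc less_irrefl by (simp add: cyclic_next_def)
  from up[OF this, of i] show ?thesis using i by simp
qed

text \<open>
  \<open>P\<close> numbers the places of each colour cyclically by \<open>0, \<dots>, j - 1\<close>. It is obtained by recursion along
  the relation of being the previous place of the same colour.
\<close>

lemma ERT_mult_of_ERT:
  assumes "ERT M"
  shows "ERT_mult M j"
  unfolding ERT_mult_def
proof (intro allI ballI)
  fix k F assume F: "F \<in> fun_codes M UNIV (NBelow M k)"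
  let ?f = "fun_app M F"
  show "\<exists>b. \<forall>x. b \<preceq> x \<longrightarrow> (\<exists>G \<in> fun_codes M (NBelow M j) UNIV.
      inj_on (fun_app M G) (NBelow M j) \<and>
      (\<forall>i \<in> NBelow M j. b \<preceq> fun_app M G i \<and> ?f (fun_app M G i) = ?f x))"
  proof (cases "j = \<zero>")
    case True
    then have empty: "NBelow M j = {}" by (auto simp: NBelow_def not_less_zero)
    obtain G where "G \<in> fun_codes M (NBelow M j) UNIV"
      by (rule fun_code_exists[of "\<lambda>_ _. False" "NBelow M j" UNIV, OF delta0_const])
        (simp_all add: empty)
    then show ?thesis unfolding empty by auto
  next
    case False
    then have j: "\<zero> \<prec> j" by (simp add: pos_iff)
    define same where "same x y \<longleftrightarrow> ?f x = ?f y" for x y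
    have same: "delta0 M (\<lambda>e. same (s e) (t e))" if "delta0_term M s" "delta0_term M t" for s t
      unfolding same_def using F that by (rule delta0_app_eq)
    define prev where
      "prev z x \<longleftrightarrow> z \<prec> x \<and> same z x \<and> (\<forall>u. u \<prec> x \<longrightarrow> z \<prec> u \<longrightarrow> \<not> same u x)" for z x
    define S where "S i i' \<longleftrightarrow> i' = cyclic_next j i" for i i'
    have "delta0 M (\<lambda>e. prev (e 0) (e 1))" unfolding prev_def by (intro same delta0_intros)
    moreover have "delta0 M (\<lambda>e. S (e 0) (e 1))"
    proof -
      have "S i i' \<longleftrightarrow> i \<oplus> \<one> \<prec> j \<and> i' = i \<oplus> \<one> \<or> \<not> i \<oplus> \<one> \<prec> j \<and> i' = \<zero>" for i i'
        by (auto simp: S_def cyclic_next_def)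
      then show ?thesis by (simp only:) (intro delta0_intros)
    qed
    moreover have "z = z'" if "prev z x" "prev z' x" for z z' x
      using that N.less_linear[of z z'] unfolding prev_def by blast
    moreover have "\<exists>i'. i' \<prec> j \<and> S i i'" for i
      using j by (simp add: S_def cyclic_next_def)
    ultimately obtain P where P: "P \<in> fun_codes M UNIV (NBelow M j)"
      and P_prev: "\<And>z x. prev z x \<Longrightarrow> S (fun_app M P z) (fun_app M P x)"
      using j by (rule_tac bounded_recursion[of prev S j \<zero>]) (auto simp: prev_def S_def)
    let ?p = "fun_app M P"
    have p_less: "?p x \<prec> j" for x using fun_app_iff(2)[OF P] by (simp add: NBelow_def)
    have f_less: "?f x \<prec> k" for x using fun_app_iff(2)[OF F] by (simp add: NBelow_def)
    define \<Gamma> where "\<Gamma> x c \<longleftrightarrow> (\<exists>u. u \<prec> k \<and> (\<exists>v. v \<prec> j \<and>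
      (?f x = u \<and> (?p x = v \<and> c = NPair M u v))))" for x c
    have \<Gamma>: "\<Gamma> x c \<longleftrightarrow> c = NPair M (?f x) (?p x)" for x c
      unfolding \<Gamma>_def using f_less p_less by blast
    have "delta0 M (\<lambda>e. \<Gamma> (e 0) (e 1))"
      unfolding \<Gamma>_def by (intro delta0_ex delta0_conj delta0_app[OF F] delta0_app[OF P] delta0_intros)
    then obtain C where C: "C \<in> fun_codes M UNIV (NBelow M (NPair M k j))"
      and C_app: "\<And>x c. \<Gamma> x c \<Longrightarrow> fun_app M C x = c"
      by (rule fun_code_exists[of \<Gamma> UNIV "NBelow M (NPair M k j)"])
        (auto simp: \<Gamma> NBelow_def intro: pair_less f_less p_less N.less_imp_le)
    have C_app: "fun_app M C x = NPair M (?f x) (?p x)" for x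
      by (rule C_app) (simp add: \<Gamma>)
    from bspec[OF spec[OF assms[unfolded ERT_def]] C] obtain b
      where b: "\<forall>x. b \<preceq> x \<longrightarrow> (\<exists>y. b \<preceq> y \<and> x \<noteq> y \<and> ?f x = ?f y \<and> ?p x = ?p y)"
      unfolding C_app pair_inject by blast
    show ?thesis
    proof (rule exI[of _ b], intro allI impI)
      fix x assume x: "b \<preceq> x"
      obtain y where y: "b \<preceq> y" "x \<noteq> y" "?f x = ?f y" "?p x = ?p y" using b x by blast
      obtain u v where uv: "b \<preceq> u" "u \<prec> v" "?f u = ?f x" "?f v = ?f x" "?p u = ?p v"
        using N.less_linear[of x y] x y by metis
      \<comment> \<open>The values of \<open>?p\<close> at places of the colour from \<open>u\<close> up to \<open>v\<close>. Omitting \<open>v\<close> loses none of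
        them, since \<open>?p u = ?p v\<close>, and leaves every place counted with a next one up to \<open>v\<close>.\<close>
      define H where "H i \<longleftrightarrow> (\<exists>z. z \<prec> v \<and> (u \<preceq> z \<and> (?f z = ?f x \<and> ?p z = i)))" for i
      have "delta0 M (\<lambda>e. H (e 0))"
        unfolding H_def
        by (intro delta0_ex delta0_conj delta0_app[OF F] delta0_app[OF P] delta0_intros)
      moreover have "H (?p u)" using uv by (auto simp: H_def)
      moreover have "H (cyclic_next j i)" if "H i" for i
      proof -
        obtain z where z: "z \<prec> v" "u \<preceq> z" "?f z = ?f x" "?p z = i" using \<open>H i\<close> by (auto simp: H_def)
        have "delta0 M (\<lambda>e. z \<prec> e 0 \<and> same z (e 0))" by (intro same delta0_intros)
        moreover have "z \<prec> v \<and> same z v" using z uv by (simp add: same_def)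
        ultimately obtain z' where z': "z \<prec> z'" "same z z'"
          "\<And>w. w \<prec> z' \<Longrightarrow> \<not> (z \<prec> w \<and> same z w)"
          using delta0_least[of "\<lambda>w. z \<prec> w \<and> same z w" v] by blast
        then have "prev z z'" unfolding prev_def same_def by metis
        from P_prev[OF this] have p': "?p z' = cyclic_next j i" by (simp add: S_def z(4))
        have "z' \<preceq> v" using z'(3)[of v] z(1,3) uv(4) by (metis N.not_less same_def)
        show ?thesis
        proof (cases "z' = v")
          case True
          then show ?thesis using \<open>H (?p u)\<close> uv(5) p' by simp
        next
          case False
          then have "z' \<prec> v" using \<open>z' \<preceq> v\<close> by (simp add: NLeq_def)
          moreover have "u \<preceq> z'" using z(2) z'(1) by (metis N.le_less_trans N.less_imp_le)
          ultimately show ?thesis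
            using p' z'(2) z(3) unfolding H_def same_def by metis
        qed
      qed
      ultimately have all: "H i" if "i \<prec> j" for i
        using cyclic_orbit_all[of H "?p u" j i] p_less that by blast
      define \<Delta> where "\<Delta> z i \<longleftrightarrow> b \<preceq> z \<and> (?f z = ?f x \<and> ?p z = i)" for z i
      have \<Delta>: "delta0 M (\<lambda>e. \<Delta> (s e) (t e))" if "delta0_term M s" "delta0_term M t" for s t
        unfolding \<Delta>_def
        by (intro delta0_conj delta0_app[OF F] delta0_app[OF P] delta0_leq that delta0_term_const)
      define \<Theta> where "\<Theta> i z \<longleftrightarrow> i \<prec> j \<and> (\<Delta> z i \<and> (\<forall>w. w \<prec> z \<longrightarrow> \<not> \<Delta> w i))" for i z
      have "delta0 M (\<lambda>e. \<Theta> (e 0) (e 1))" unfolding \<Theta>_def by (intro \<Delta> delta0_intros)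
      moreover have "i \<in> NBelow M j \<and> z \<in> UNIV" if "\<Theta> i z" for i z
        using that by (simp add: \<Theta>_def NBelow_def)
      moreover have \<Theta>_ex: "\<exists>z. \<Theta> i z" if "i \<in> NBelow M j" for i
      proof -
        have "i \<prec> j" using that by (simp add: NBelow_def)
        then obtain z where "u \<preceq> z" "?f z = ?f x" "?p z = i" using all by (auto simp: H_def)
        then have "\<Delta> z i" using uv(1) N.order_trans by (auto simp: \<Delta>_def)
        moreover have "delta0 M (\<lambda>e. \<Delta> (e 0) i)" by (intro \<Delta> delta0_intros)
        ultimately show ?thesis
          using delta0_least[of "\<lambda>z. \<Delta> z i"] \<open>i \<prec> j\<close> unfolding \<Theta>_def by blast
      qed
      moreover have "z = z'" if "\<Theta> i z" "\<Theta> i z'" for i z z'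
        using that N.less_linear[of z z'] unfolding \<Theta>_def by blast
      ultimately obtain G where G: "G \<in> fun_codes M (NBelow M j) UNIV"
        and G_app: "\<And>i z. \<Theta> i z \<Longrightarrow> fun_app M G i = z"
        using fun_code_exists[of \<Theta> "NBelow M j" UNIV] by blast
      have G_\<Delta>: "\<Delta> (fun_app M G i) i" if "i \<in> NBelow M j" for i
        using \<Theta>_ex[OF that] G_app unfolding \<Theta>_def by blast
      have "inj_on (fun_app M G) (NBelow M j)"
        by (rule inj_on_inverseI[of _ ?p]) (use G_\<Delta> in \<open>simp add: \<Delta>_def\<close>)
      then show "\<exists>G \<in> fun_codes M (NBelow M j) UNIV. inj_on (fun_app M G) (NBelow M j) \<and>
          (\<forall>i \<in> NBelow M j. b \<preceq> fun_app M G i \<and> ?f (fun_app M G i) = ?f x)"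
        using G G_\<Delta> by (intro bexI[of _ G]) (auto simp: \<Delta>_def)
    qed
  qed
qed

section \<open>Maximal codes and strong bounding\<close>

text \<open>
  Without a largest \<open>s < A\<close> that satisfies \<open>\<exists>w. R s w\<close>, induction would yield such \<open>s\<close> above every
  \<open>n\<close>, even above \<open>A\<close>. A largest code is maximal for inclusion by \<open>bits_mono\<close>.
\<close>

lemma maximal_code:
  assumes "ISigma01 M" and R: "delta0 M (\<lambda>e. R (e 0) (e 1))" and s0: "s0 \<prec> A" "R s0 w0"
  obtains s w where "s \<prec> A" "R s w"
    "\<And>s' w' i. s' \<prec> A \<Longrightarrow> R s' w' \<Longrightarrow> (\<And>i. bit s i \<Longrightarrow> bit s' i) \<Longrightarrow> bit s' i \<Longrightarrow> bit s i"
proof -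
  have "\<exists>s w. s \<prec> A \<and> R s w \<and> (\<forall>s' w'. s \<prec> s' \<longrightarrow> s' \<prec> A \<longrightarrow> \<not> R s' w')"
  proof (rule ccontr)
    assume no_max: "\<not> ?thesis"
    have "\<exists>w. \<exists>s. s \<prec> A \<and> (n \<preceq> s \<and> R s w)" for n
    proof (rule Sigma01_induct[OF assms(1)])
      show "delta0 M (\<lambda>e. \<exists>s. s \<prec> A \<and> (e 0 \<preceq> s \<and> R s (e 1)))"
        by (intro delta0_intros delta0_subst2[OF R])
      show "\<exists>w. \<exists>s. s \<prec> A \<and> (\<zero> \<preceq> s \<and> R s w)" using s0 by auto
      fix n assume "\<exists>w. \<exists>s. s \<prec> A \<and> (n \<preceq> s \<and> R s w)"
      then obtain s w where "s \<prec> A" "n \<preceq> s" "R s w" by blast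
      moreover from this no_max obtain s' w' where "s \<prec> s'" "s' \<prec> A" "R s' w'" by blast
      ultimately show "\<exists>w. \<exists>s. s \<prec> A \<and> (n \<oplus> \<one> \<preceq> s \<and> R s w)"
        by (auto simp: Suc_leq_iff intro: N.le_less_trans)
    qed
    then show False using N.not_less by blast
  qed
  then obtain s w where s: "s \<prec> A" "R s w"
    "\<And>s' w'. s \<prec> s' \<Longrightarrow> s' \<prec> A \<Longrightarrow> \<not> R s' w'" by blast
  show thesis
  proof (rule that[OF s(1,2)])
    fix s' w' i assume s': "s' \<prec> A" "R s' w'" "\<And>i. bit s i \<Longrightarrow> bit s' i" "bit s' i"
    from s'(3) have "s \<preceq> s'" by (rule bits_mono)
    moreover have "\<not> s \<prec> s'" using s(3) s'(1,2) by blast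
    ultimately show "bit s i" using s'(4) by (simp add: NLeq_def)
  qed
qed

lemma not_bit_zero: "\<not> bit \<zero> i"
  using bit_less not_less_zero by blast

text \<open>
  Among the sets of numbers below \<open>a\<close> whose elements have a common bound on witnesses, a maximal
  one contains every number below \<open>a\<close> that has a witness at all, since one element more only
  increases the bound.
\<close>

lemma strong_bounding:
  assumes "ISigma01 M" and Q: "delta0 M (\<lambda>e. Q (e 0) (e 1))"
  obtains w where "\<And>n y. n \<prec> a \<Longrightarrow> Q n y \<Longrightarrow> \<exists>y. y \<prec> w \<and> Q n y"
proof -
  let ?R = "\<lambda>s w. \<forall>n. n \<prec> a \<longrightarrow> bit s n \<longrightarrow> (\<exists>y. y \<prec> w \<and> Q n y)"
  have "delta0 M (\<lambda>e. ?R (e 0) (e 1))" by (intro delta0_bit delta0_intros delta0_subst2[OF Q])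
  moreover have "?R \<zero> \<zero>" using not_bit_zero by blast
  ultimately obtain s w where s: "s \<prec> pow2 a" "?R s w"
    "\<And>s' w' i. s' \<prec> pow2 a \<Longrightarrow> ?R s' w' \<Longrightarrow> (\<And>i. bit s i \<Longrightarrow> bit s' i) \<Longrightarrow> bit s' i \<Longrightarrow> bit s i"
    using pow2_pos by (rule_tac maximal_code[OF assms(1), of ?R \<zero> "pow2 a" \<zero>]) blast+
  have "\<exists>y. y \<prec> w \<and> Q n y" if n: "n \<prec> a" and y: "Q n y" for n y
  proof -
    have "delta0 M (\<lambda>e. bit s (e 0) \<or> e 0 = n)" by (intro delta0_bit delta0_intros)
    then obtain s' where s': "s' \<prec> pow2 a" "\<And>i. bit s' i \<longleftrightarrow> i \<prec> a \<and> (bit s i \<or> i = n)"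
      by (rule finite_set_code) blast
    have w: "v \<prec> w \<oplus> (y \<oplus> \<one>)" if "v \<prec> w" for v
      using that leq_add1 N.less_le_trans by blast
    have y': "y \<prec> w \<oplus> (y \<oplus> \<one>)" using less_Suc leq_add2 N.less_le_trans by blast
    have "?R s' (w \<oplus> (y \<oplus> \<one>))"
    proof (intro allI impI)
      fix m assume "m \<prec> a" "bit s' m"
      then have "bit s m \<or> m = n" by (simp add: s'(2))
      then show "\<exists>v. v \<prec> w \<oplus> (y \<oplus> \<one>) \<and> Q m v"
        using s(2) \<open>m \<prec> a\<close> w y y' by blast
    qed
    moreover have "bit s' i" if "bit s i" for i
      using that not_bit_pow2[OF s(1), of i] N.not_less[of i a] s'(2) by blast
    moreover have "bit s' n" using n by (simp add: s'(2))
    ultimately have "bit s n" using s(3)[OF s'(1)] by blast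
    then show ?thesis using s(2) n by blast
  qed
  then show thesis by (rule that)
qed

end

section \<open>Repetition from induction\<close>

locale coloring = rca_star +
  fixes F :: "'a set" and k :: 'a
  assumes F: "F \<in> fun_codes M UNIV (NBelow M k)"
begin

abbreviation col :: "'a \<Rightarrow> 'a" where "col \<equiv> fun_app M F"

definition edge :: "'a \<Rightarrow> 'a \<Rightarrow> 'a \<Rightarrow> bool" where
  "edge x y u \<longleftrightarrow> u = NPair M (col x) (col y)"

definition same :: "'a \<Rightarrow> 'a \<Rightarrow> bool" where
  "same x y \<longleftrightarrow> col x = col y"

text \<open>
  \<open>t\<close> codes a finite set, by \<open>bit\<close>. Any earlier place \<open>y\<close> with the colour of an element \<open>x\<close> is at most
  the element that precedes \<open>x\<close> in this set.
\<close>

definition chain :: "'a \<Rightarrow> bool" where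
  "chain t \<longleftrightarrow>
    (\<forall>x. x \<prec> t \<longrightarrow> bit t x \<longrightarrow> (\<forall>y. y \<prec> x \<longrightarrow> same y x \<longrightarrow> (\<exists>z. z \<prec> x \<and> (bit t z \<and> y \<preceq> z)))) \<and>
    (\<forall>x. x \<prec> t \<longrightarrow> (\<forall>y. y \<prec> t \<longrightarrow> bit t x \<longrightarrow> bit t y \<longrightarrow> same x y \<longrightarrow> x = y))"

definition pattern :: "'a \<Rightarrow> 'a \<Rightarrow> bool" where
  "pattern t s \<longleftrightarrow> (\<forall>u. u \<prec> NPair M k k \<longrightarrow> (bit s u \<longleftrightarrow>
    (\<exists>x. x \<prec> t \<and> (\<exists>y. y \<prec> t \<and> (bit t x \<and> (bit t y \<and> (x \<preceq> y \<and> edge x y u)))))))"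

text \<open>
  The pattern \<open>s\<close> is refuted if a colour of a chain with this pattern occurs again after its place in
  the chain. The number \<open>w\<close> bounds all witnesses, as \<open>strong_bounding\<close> allows only one of them.
\<close>

definition refutes :: "'a \<Rightarrow> 'a \<Rightarrow> bool" where
  "refutes s w \<longleftrightarrow> (\<exists>t. t \<prec> w \<and> (\<exists>x. x \<prec> w \<and> (\<exists>y. y \<prec> w \<and>
    (chain t \<and> (pattern t s \<and> (bit t x \<and> (x \<prec> y \<and> same x y)))))))"

lemma col_less: "col x \<prec> k"
  using fun_app_iff(2)[OF F] by (simp add: NBelow_def)

lemma edge_less: "edge x y u \<Longrightarrow> u \<prec> NPair M k k"
  by (simp add: edge_def pair_less col_less N.less_imp_le)

lemma delta0_same: "delta0_term M f \<Longrightarrow> delta0_term M g \<Longrightarrow> delta0 M (\<lambda>e. same (f e) (g e))"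
  unfolding same_def by (rule delta0_app_eq[OF F])

lemma delta0_edge:
  assumes "delta0_term M f" "delta0_term M g" "delta0_term M h"
  shows "delta0 M (\<lambda>e. edge (f e) (g e) (h e))"
proof (rule delta0_subst3[OF _ assms])
  have "edge x y u \<longleftrightarrow> (\<exists>c. c \<prec> k \<and> (\<exists>d. d \<prec> k \<and> (col x = c \<and> (col y = d \<and> u = NPair M c d))))"
    for x y u unfolding edge_def using col_less by blast
  then show "delta0 M (\<lambda>e. edge (e 0) (e 1) (e 2))"
    by (simp only:) (intro delta0_ex delta0_conj delta0_app[OF F] delta0_intros)
qed

lemma delta0_chain: "delta0_term M f \<Longrightarrow> delta0 M (\<lambda>e. chain (f e))"
  by (rule delta0_subst1, unfold chain_def) (intro delta0_same delta0_bit delta0_intros)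

lemma delta0_pattern:
  "delta0_term M f \<Longrightarrow> delta0_term M g \<Longrightarrow> delta0 M (\<lambda>e. pattern (f e) (g e))"
  by (rule delta0_subst2, unfold pattern_def)
    (intro delta0_iff delta0_edge delta0_bit delta0_intros)

lemma delta0_refutes:
  "delta0_term M f \<Longrightarrow> delta0_term M g \<Longrightarrow> delta0 M (\<lambda>e. refutes (f e) (g e))"
  by (rule delta0_subst2, unfold refutes_def)
    (intro delta0_chain delta0_pattern delta0_same delta0_bit delta0_intros)

lemma chain_iff: "chain t \<longleftrightarrow>
    (\<forall>x y. bit t x \<longrightarrow> y \<prec> x \<longrightarrow> col y = col x \<longrightarrow> (\<exists>z. z \<prec> x \<and> bit t z \<and> y \<preceq> z)) \<and>
    (\<forall>x y. bit t x \<longrightarrow> bit t y \<longrightarrow> col x = col y \<longrightarrow> x = y)"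
  unfolding chain_def same_def using bit_less by blast

lemma pattern_iff:
  assumes "s \<prec> pow2 (NPair M k k)"
  shows "pattern t s \<longleftrightarrow>
    (\<forall>u. bit s u \<longleftrightarrow> (\<exists>x y. bit t x \<and> bit t y \<and> x \<preceq> y \<and> u = NPair M (col x) (col y)))"
proof -
  have *: "pattern t s \<longleftrightarrow> (\<forall>u. u \<prec> NPair M k k \<longrightarrow>
      (bit s u \<longleftrightarrow> (\<exists>x y. bit t x \<and> bit t y \<and> x \<preceq> y \<and> edge x y u)))"
    unfolding pattern_def using bit_less by meson
  have "u \<prec> NPair M k k" if "bit s u" for u
    using that not_bit_pow2[OF assms, of u] N.not_less[of u] by blast
  then show ?thesis unfolding * using edge_less unfolding edge_def by blast
qed

lemma refutesI:
  assumes "chain t" "pattern t s" "bit t x" "x \<prec> y" "col x = col y"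
  shows "\<exists>w. refutes s w"
proof -
  have "t \<prec> t \<oplus> y \<oplus> \<one>" "y \<prec> t \<oplus> y \<oplus> \<one>"
    by (simp_all add: less_Suc_iff_leq leq_add1 leq_add2)
  moreover from this assms(4) have "x \<prec> t \<oplus> y \<oplus> \<one>" using less_trans by blast
  ultimately show ?thesis using assms unfolding refutes_def same_def by blast
qed

text \<open>
  Let \<open>z\<close> be the first place at which the chains differ, in \<open>t\<close> but not in \<open>t'\<close>. In \<open>t'\<close> its colour can
  only be taken at some \<open>y\<close> after \<open>z\<close>, and then \<open>t'\<close> has an element \<open>u\<close> between \<open>z\<close> and \<open>y\<close>. The pattern
  puts the colour of \<open>u\<close> before that of \<open>z\<close>, so \<open>t\<close> takes it before \<open>z\<close>, and so does \<open>t'\<close>, which then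
  takes it twice.
\<close>

lemma pattern_determines_chain_aux:
  assumes chains: "chain t" "chain t'"
    and pat: "\<And>c d. (\<exists>x y. bit t x \<and> bit t y \<and> x \<preceq> y \<and> c = col x \<and> d = col y) \<longleftrightarrow>
      (\<exists>x y. bit t' x \<and> bit t' y \<and> x \<preceq> y \<and> c = col x \<and> d = col y)"
    and below: "\<And>w. w \<prec> z \<Longrightarrow> bit t w \<longleftrightarrow> bit t' w"
    and z: "bit t z"
  shows "bit t' z"
proof (rule ccontr)
  assume not: "\<not> bit t' z"
  have inj: "x = y" if "bit t x" "bit t y" "col x = col y" for x y
    using chains(1) that unfolding chain_iff by blast
  have inj': "x = y" if "bit t' x" "bit t' y" "col x = col y" for x y
    using chains(2) that unfolding chain_iff by blast
  have "\<exists>x y. bit t x \<and> bit t y \<and> x \<preceq> y \<and> col z = col x \<and> col z = col y"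
    using z N.order_refl[of z] by blast
  from this[unfolded pat] obtain y where y: "bit t' y" "col y = col z" by auto
  have "y \<noteq> z" using y(1) not by blast
  moreover have "\<not> y \<prec> z" using below inj[OF _ z y(2)] y(1) \<open>y \<noteq> z\<close> by blast
  ultimately have "z \<prec> y" using N.less_linear by blast
  then obtain u where u: "u \<prec> y" "bit t' u" "z \<preceq> u"
    using chains(2)[unfolded chain_iff, THEN conjunct1, rule_format, of y z] y by auto
  then have "z \<prec> u" using not by (auto simp: NLeq_def)
  have "\<exists>x y. bit t' x \<and> bit t' y \<and> x \<preceq> y \<and> col u = col x \<and> col z = col y"
    using u(2) y N.less_imp_le[OF u(1)] by (intro exI[of _ u] exI[of _ y]) simp
  then obtain x x' where x: "bit t x" "bit t x'" "x \<preceq> x'" "col u = col x" "col z = col x'"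
    using pat[of "col u" "col z"] by blast
  have "x' = z" using inj[OF z x(2,5)] by simp
  moreover have "x \<noteq> z" using inj'[OF u(2) y(1)] u(1) x(4) y(2) less_irrefl by auto
  ultimately have "x \<prec> z" using x(3) by (simp add: NLeq_def)
  then have "x = u" using below x(1) inj'[OF u(2), of x] x(4) by auto
  then show False using \<open>x \<prec> z\<close> \<open>z \<prec> u\<close> less_trans less_irrefl by blast
qed

lemma pattern_determines_chain:
  assumes "s \<prec> pow2 (NPair M k k)" and t: "chain t" "pattern t s" and t': "chain t'" "pattern t' s"
  shows "bit t z \<longleftrightarrow> bit t' z"
proof (rule delta0_less_induct[of "\<lambda>z. bit t z \<longleftrightarrow> bit t' z"])
  show "delta0 M (\<lambda>e. bit t (e 0) \<longleftrightarrow> bit t' (e 0))" by (intro delta0_iff delta0_bit delta0_intros)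
  have pat_code: "bit s (NPair M c d) \<longleftrightarrow>
      (\<exists>x y. bit t x \<and> bit t y \<and> x \<preceq> y \<and> c = col x \<and> d = col y)" if "pattern t s" for t c d
    using that[unfolded pattern_iff[OF assms(1)], THEN spec, of "NPair M c d"]
    unfolding pair_inject .
  have pat: "(\<exists>x y. bit t x \<and> bit t y \<and> x \<preceq> y \<and> c = col x \<and> d = col y) \<longleftrightarrow>
      (\<exists>x y. bit t' x \<and> bit t' y \<and> x \<preceq> y \<and> c = col x \<and> d = col y)" for c d
    unfolding pat_code[OF t(2), symmetric] pat_code[OF t'(2), symmetric] by (rule refl)
  fix z assume IH: "\<And>w. w \<prec> z \<Longrightarrow> bit t w \<longleftrightarrow> bit t' w"
  show "bit t z \<longleftrightarrow> bit t' z"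
  proof
    show "bit t z \<Longrightarrow> bit t' z"
      by (rule pattern_determines_chain_aux[OF t(1) t'(1) pat IH])
    show "bit t' z \<Longrightarrow> bit t z"
      by (rule pattern_determines_chain_aux[OF t'(1) t(1) pat[symmetric] IH[symmetric]])
  qed
qed

text \<open>
  \<open>valid\<close> says that a pattern is realised and not refuted. Deciding this below the two bounds from
  \<open>strong_bounding\<close> makes it definable by a bounded formula, so that a maximal valid pattern exists.
  Any chain \<open>t\<close> that realises it can be extended by a later place \<open>x\<close>, and the pattern of the
  extension is valid because it determines its chain.
\<close>

lemma eventually_repeats:
  assumes "ISigma01 M"
  shows "\<exists>b. \<forall>x. b \<preceq> x \<longrightarrow> (\<exists>y. b \<preceq> y \<and> x \<noteq> y \<and> col x = col y)"
proof (rule ccontr)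
  assume "\<not> ?thesis"
  then have single: "\<exists>x. b \<preceq> x \<and> (\<forall>y. b \<preceq> y \<longrightarrow> col x = col y \<longrightarrow> y = x)" for b by metis
  let ?K = "pow2 (NPair M k k)"
  define Q where "Q s t \<longleftrightarrow> chain t \<and> pattern t s" for s t
  have Q: "delta0 M (\<lambda>e. Q (f e) (g e))" if "delta0_term M f" "delta0_term M g" for f g
    unfolding Q_def by (intro delta0_conj delta0_chain delta0_pattern that)
  obtain w where w: "\<And>s t. s \<prec> ?K \<Longrightarrow> Q s t \<Longrightarrow> \<exists>t. t \<prec> w \<and> Q s t"
    using strong_bounding[of Q, OF assms Q[OF delta0_term_var delta0_term_var], of ?K] by blast
  obtain w' where w': "\<And>s v. s \<prec> ?K \<Longrightarrow> refutes s v \<Longrightarrow> \<exists>v. v \<prec> w' \<and> refutes s v"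
    using strong_bounding[of refutes, OF assms delta0_refutes[OF delta0_term_var delta0_term_var], of ?K] by blast
  define valid where
    "valid s \<longleftrightarrow> (\<exists>t. t \<prec> w \<and> Q s t) \<and> \<not> (\<exists>v. v \<prec> w' \<and> refutes s v)" for s
  have valid_iff: "valid s \<longleftrightarrow> (\<exists>t. Q s t) \<and> \<not> (\<exists>v. refutes s v)" if "s \<prec> ?K" for s
    unfolding valid_def using w[OF that] w'[OF that] by blast
  have "delta0 M (\<lambda>e. valid (e 0))"
    unfolding valid_def by (intro Q delta0_refutes delta0_intros)
  moreover have "valid \<zero>"
  proof -
    have "chain \<zero>" by (simp add: chain_iff not_bit_zero)
    moreover have "pattern \<zero> \<zero>" by (simp add: pattern_iff[OF pow2_pos] not_bit_zero)
    moreover have "\<not> refutes \<zero> v" for v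
    proof
      assume "refutes \<zero> v"
      then obtain t x where "pattern t \<zero>" "bit t x" unfolding refutes_def by blast
      then show False
        using not_bit_zero N.order_refl unfolding pattern_iff[OF pow2_pos] by blast
    qed
    ultimately show ?thesis unfolding valid_iff[OF pow2_pos] Q_def by blast
  qed
  ultimately obtain s where s: "s \<prec> ?K" "valid s"
    "\<And>s' i. s' \<prec> ?K \<Longrightarrow> valid s' \<Longrightarrow> (\<And>i. bit s i \<Longrightarrow> bit s' i) \<Longrightarrow> bit s' i \<Longrightarrow> bit s i"
    using pow2_pos by (rule_tac maximal_code[OF assms, of "\<lambda>s _. valid s" \<zero> ?K]) blast+
  then obtain t where t: "chain t" "pattern t s" and unrefuted: "\<And>v. \<not> refutes s v"
    unfolding valid_iff[OF s(1)] Q_def by blast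
  have t_last: "col x \<noteq> col y" if "bit t x" "x \<prec> y" for x y
    using refutesI[OF t that] unrefuted by blast
  \<comment> \<open>Because \<open>b\<close> is the least bound of the set coded by \<open>t\<close>, every place below \<open>b\<close> is separated
    from \<open>x\<close> by an element of this set.\<close>
  have "delta0 M (\<lambda>e. \<forall>x. x \<prec> t \<longrightarrow> bit t x \<longrightarrow> x \<prec> e 0)" by (intro delta0_bit delta0_intros)
  then obtain b where b: "\<forall>x. x \<prec> t \<longrightarrow> bit t x \<longrightarrow> x \<prec> b"
    "\<forall>c. c \<prec> b \<longrightarrow> \<not> (\<forall>x. x \<prec> t \<longrightarrow> bit t x \<longrightarrow> x \<prec> c)"
    using delta0_least[of "\<lambda>b. \<forall>x. x \<prec> t \<longrightarrow> bit t x \<longrightarrow> x \<prec> b" t] by blast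
  have b_above: "x \<prec> b" if "bit t x" for x using b(1) that bit_less by blast
  have b_least: "\<exists>x. bit t x \<and> c \<preceq> x" if "c \<prec> b" for c
    using b(2) that N.not_less by blast
  obtain x where x: "b \<preceq> x" "\<And>y. b \<preceq> y \<Longrightarrow> col x = col y \<Longrightarrow> y = x" using single by blast
  have x_above: "z \<prec> x" if "bit t z" for z using b_above[OF that] x(1) N.less_le_trans by blast
  have "delta0 M (\<lambda>e. bit t (e 0) \<or> e 0 = x)" by (intro delta0_bit delta0_intros)
  from finite_set_code[of "\<lambda>i. bit t i \<or> i = x", OF this, of "x \<oplus> \<one>"]
  obtain t' where "\<forall>i. bit t' i \<longleftrightarrow> i \<prec> x \<oplus> \<one> \<and> (bit t i \<or> i = x)" by metis
  then have t': "bit t' i \<longleftrightarrow> bit t i \<or> i = x" for i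
    using x_above less_Suc_iff by blast
  have "delta0 M (\<lambda>e. \<exists>y. y \<prec> t' \<and> (\<exists>z. z \<prec> t' \<and> (bit t' y \<and> (bit t' z \<and> (y \<preceq> z \<and> edge y z (e 0))))))"
    by (intro delta0_bit delta0_edge delta0_intros)
  from finite_set_code[of "\<lambda>u. \<exists>y. y \<prec> t' \<and> (\<exists>z. z \<prec> t' \<and> (bit t' y \<and> (bit t' z \<and> (y \<preceq> z \<and> edge y z u))))",
      OF this, of "NPair M k k"]
  obtain s' where s': "s' \<prec> ?K" "pattern t' s'" unfolding pattern_def by metis
  have pat: "bit s u \<longleftrightarrow> (\<exists>x y. bit t x \<and> bit t y \<and> x \<preceq> y \<and> u = NPair M (col x) (col y))" for u
    using t(2) unfolding pattern_iff[OF s(1)] by blast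
  have pat': "bit s' u \<longleftrightarrow> (\<exists>x y. bit t' x \<and> bit t' y \<and> x \<preceq> y \<and> u = NPair M (col x) (col y))" for u
    using s'(2) unfolding pattern_iff[OF s'(1)] by blast
  have chain': "chain t'"
    unfolding chain_iff
  proof (intro conjI allI impI)
    fix v y assume v: "bit t' v" "y \<prec> v" "col y = col v"
    show "\<exists>z. z \<prec> v \<and> bit t' z \<and> y \<preceq> z"
    proof (cases "bit t v")
      case True
      then show ?thesis using t(1) v(2,3) unfolding chain_iff t' by blast
    next
      case False
      then have "v = x" using v(1) t' by blast
      then have "\<not> b \<preceq> y" using x(2)[of y] v(2,3) less_irrefl by auto
      then obtain z where "bit t z" "y \<preceq> z" using b_least N.not_le by blast
      then show ?thesis using x_above t' \<open>v = x\<close> by blast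
    qed
  next
    fix v y assume "bit t' v" "bit t' y" and eq: "col v = col y"
    then consider "bit t v" "bit t y" | "bit t v" "y = x" | "v = x" "bit t y" | "v = x" "y = x"
      using t' by blast
    then show "v = y"
    proof cases
      case 1
      then show ?thesis using t(1) eq unfolding chain_iff by blast
    next
      case 2
      then show ?thesis using t_last[OF 2(1) x_above[OF 2(1)]] eq by simp
    next
      case 3
      then show ?thesis using t_last[OF 3(2) x_above[OF 3(2)]] eq by simp
    qed simp
  qed
  have "\<not> refutes s' v" for v
  proof
    assume "refutes s' v"
    then obtain t'' p q where *: "chain t''" "pattern t'' s'" "bit t'' p" "p \<prec> q" "col p = col q"
      unfolding refutes_def same_def by blast
    have "bit t' p"
      using pattern_determines_chain[OF s'(1) chain' s'(2) *(1,2)] *(3) by blast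
    then consider "bit t p" | "p = x" using t' by blast
    then show False
    proof cases
      case 1
      then show ?thesis using t_last *(4,5) by blast
    next
      case 2
      then have "b \<preceq> q" using x(1) *(4) N.le_less_trans N.less_imp_le by blast
      then show ?thesis using x(2)[of q] *(4,5) 2 less_irrefl by auto
    qed
  qed
  then have "valid s'" unfolding valid_iff[OF s'(1)] Q_def using chain' s'(2) by blast
  moreover have "bit s' u" if "bit s u" for u
    using that t' unfolding pat pat' by blast
  moreover have "bit s' (NPair M (col x) (col x))"
    using t'[of x] N.order_refl unfolding pat' by blast
  ultimately have "bit s (NPair M (col x) (col x))" using s(3)[OF s'(1)] by blast
  then obtain y where "bit t y" "col y = col x" unfolding pat pair_inject by metis
  then show False using t_last x_above by blast
qed

end

lemma (in rca_star) ERT_of_ISigma01: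
  assumes "ISigma01 M"
  shows "ERT M"
  unfolding ERT_def
proof (intro allI ballI)
  fix k F assume "F \<in> fun_codes M UNIV (NBelow M k)"
  then interpret coloring M F k by unfold_locales
  show "\<exists>b. \<forall>x. b \<preceq> x \<longrightarrow> (\<exists>y. b \<preceq> y \<and> x \<noteq> y \<and> col x = col y)"
    using assms by (rule eventually_repeats)
qed

theorem theorem6:
  fixes M :: "'a l2_structure"
  assumes "models_RCA0_star M"
  shows "(ISigma01 M \<longleftrightarrow> ERT M) \<and> (ERT M \<longleftrightarrow> (\<forall>j. ERT_mult M j))"
proof -
  interpret rca_star M using assms by unfold_locales
  show ?thesis
    using ERT_of_ISigma01 ISigma01_of_ERT ERT_mult_of_ERT ERT_of_ERT_mult by blast
qed

end
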